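(* From $\mathcal{G}(M)$, one can deduce whether a matroid $M$ is a proper free product; that is, if $M$ and $M'$ are matroids with $\mathcal{G}(M)=\mathcal{G}(M')$, then $M$ is a proper free product if and only if $M'$ is. Also, for each pinchpoint $X$ of $\mathcal{Z}(M)$, the $\mathcal{G}$-invariants of the constituents of the corresponding sharp free product factorization $M=(M|X)\mathbin{\Box}(M/X)$ can be derived from $\mathcal{G}(M)$ and $r(X)$; that is, if $\mathcal{G}(M)=\mathcal{G}(M')$, $X$ is a pinchpoint of $\mathcal{Z}(M)$, $X'$ is a pinchpoint of $\mathcal{Z}(M')$, and $r_M(X)=r_{M'}(X')$, then $\mathcal{G}(M|X)=\mathcal{G}(M'|X')$ and $\mathcal{G}(M/X)=\mathcal{G}(M'/X')$.
   Context: A cyclic flat of a matroid $M$ is a flat that is a union of circuits (equivalently, a flat $X$ such that $M|X$ has no coloops). $\mathcal{Z}(M)$ is the lattice of cyclic flats of $M$, ordered by inclusion. A pinchpoint of $\mathcal{Z}(M)$ is a cyclic flat, neither the maximum nor the minimum of $\mathcal{Z}(M)$, that each cyclic flat either contains or is contained in. For matroids $M_1,M_2$ of ranks $r_1,r_2$ on disjoint sets $E_1,E_2$, the free product $M_1\mathbin{\Box}M_2$ is the matroid on $E_1\cup E_2$ whose bases are the subsets $B$ of size $r_1+r_2$ such that $B\cap E_1$ is independent in $M_1$ and $B\cap E_2$ spans $M_2$. A free product $M_1\mathbin{\Box}M_2$ is proper if each of $M_1$ and $M_2$ has at least two cyclic flats; it is sharp if it is proper, $M_1$ has no coloops, and $M_2$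 has no loops. It is known (Crapo–Schmitt) that $M$ is a proper free product if and only if $\mathcal{Z}(M)$ has a pinchpoint, and that $X\mapsto(M|X)\mathbin{\Box}(M/X)$ is a bijection from the set of pinchpoints of $\mathcal{Z}(M)$ onto the set of sharp free product factorizations of $M$. $\mathcal{G}(n,r)$ is the vector space over a field of characteristic zero with basis the formal symbols $[\underline{r}]$, one for each $0,1$-sequence of length $n$ with exactly $r$ ones. For a rank-$r$ matroid $M$ with rank function $r(\cdot)$ on an $n$-element set $E$ and a permutation (linear ordering) $\pi$ of $E$, the rank sequence $\underline{r}(\pi)=r_1\ldots r_n$ has $r_j=r(\{\pi(1),\ldots,\pi(j)\})-r(\{\pi(1),\ldots,\pi(j-1)\})$, and $\mathcal{G}(M)=\sum_\pi[\underline{r}(\pi)]\in\mathcal{G}(n,r)$ over all $n!$ permutations of $E$. *)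

theory Defs
  imports
    "HOL-Combinatorics.Multiset_Permutations"
    "HOL-Library.Poly_Mapping"
begin

section \<open>Finite matroids, presented by their independent sets\<close>

record 'a indep_struct =
  ground :: "'a set"
  indeps :: "'a set set"

locale matroid =
  fixes M :: "'a indep_struct"
  assumes finite_ground: "finite (ground M)"
    and indeps_subset: "I \<in> indeps M \<Longrightarrow> I \<subseteq> ground M"
    and empty_indep: "{} \<in> indeps M"
    and indep_mono: "I \<in> indeps M \<Longrightarrow> J \<subseteq> I \<Longrightarrow> J \<in> indeps M"
    and indep_augment: "I \<in> indeps M \<Longrightarrow> J \<in> indeps M \<Longrightarrow> card I < card J \<Longrightarrow>
          \<exists>x \<in> J - I. insert x I \<in> indeps M"

definition rk :: "'a indep_struct \<Rightarrow> 'a set \<Rightarrow> nat" where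
  "rk M X = Max (card ` {I \<in> indeps M. I \<subseteq> X})"

definition circuits :: "'a indep_struct \<Rightarrow> 'a set set" where
  "circuits M = {C. C \<subseteq> ground M \<and> C \<notin> indeps M \<and> (\<forall>D. D \<subset> C \<longrightarrow> D \<in> indeps M)}"

definition flats :: "'a indep_struct \<Rightarrow> 'a set set" where
  "flats M = {X. X \<subseteq> ground M \<and> (\<forall>x \<in> ground M - X. rk M X < rk M (insert x X))}"

definition cyclic_flats :: "'a indep_struct \<Rightarrow> 'a set set" where
  "cyclic_flats M = {X \<in> flats M. \<exists>\<C> \<subseteq> circuits M. X = \<Union>\<C>}"

definition pinchpoint :: "'a indep_struct \<Rightarrow> 'a set \<Rightarrow> bool" where
  "pinchpoint M X \<longleftrightarrow> X \<in> cyclic_flats M \<and>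
     \<not> (\<forall>Y \<in> cyclic_flats M. Y \<subseteq> X) \<and>
     \<not> (\<forall>Y \<in> cyclic_flats M. X \<subseteq> Y) \<and>
     (\<forall>Y \<in> cyclic_flats M. X \<subseteq> Y \<or> Y \<subseteq> X)"

definition restriction :: "'a indep_struct \<Rightarrow> 'a set \<Rightarrow> 'a indep_struct" where
  "restriction M X = \<lparr> ground = X, indeps = {I \<in> indeps M. I \<subseteq> X} \<rparr>"

text \<open>The rank function of the contraction is \<open>Y \<mapsto> rk M (Y \<union> X) - rk M X\<close>; its independent
  sets are the sets whose rank in the contraction is their cardinality.\<close>

definition contraction :: "'a indep_struct \<Rightarrow> 'a set \<Rightarrow> 'a indep_struct" where
  "contraction M X =
     \<lparr> ground = ground M - X,
       indeps = {I. I \<subseteq> ground M - X \<and> rk M (I \<union> X) = card I + rk M X} \<rparr>"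


section \<open>Free products\<close>

definition free_product_bases :: "'a indep_struct \<Rightarrow> 'a indep_struct \<Rightarrow> 'a set set" where
  "free_product_bases M1 M2 =
     {B. B \<subseteq> ground M1 \<union> ground M2 \<and>
         card B = rk M1 (ground M1) + rk M2 (ground M2) \<and>
         B \<inter> ground M1 \<in> indeps M1 \<and>
         rk M2 (B \<inter> ground M2) = rk M2 (ground M2)}"

definition free_product :: "'a indep_struct \<Rightarrow> 'a indep_struct \<Rightarrow> 'a indep_struct" where
  "free_product M1 M2 =
     \<lparr> ground = ground M1 \<union> ground M2,
       indeps = {I. \<exists>B \<in> free_product_bases M1 M2. I \<subseteq> B} \<rparr>"

definition proper_free_product :: "'a indep_struct \<Rightarrow> bool" where
  "proper_free_product M \<longleftrightarrow>
     (\<exists>M1 M2. matroid M1 \<and> matroid M2 \<and> ground M1 \<inter> ground M2 = {} \<and>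
        2 \<le> card (cyclic_flats M1) \<and> 2 \<le> card (cyclic_flats M2) \<and>
        M = free_product M1 M2)"


section \<open>The G-invariant\<close>

text \<open>The difference below is a truncated one on natural numbers; no truncation occurs, since
  \<open>rk M\<close> is monotone.\<close>

definition rank_seq :: "'a indep_struct \<Rightarrow> 'a list \<Rightarrow> nat list" where
  "rank_seq M xs =
     map (\<lambda>j. rk M (set (take (Suc j) xs)) - rk M (set (take j xs))) [0..<length xs]"

text \<open>All the spaces \<open>G_space n r\<close> are subspaces of one space, with basis all lists of natural
  numbers. The G-invariant is nonzero, so G-invariants of matroids that differ in the size
  of the ground set or in the rank are never equal.\<close>

definition G_space :: "nat \<Rightarrow> nat \<Rightarrow> (nat list \<Rightarrow>\<^sub>0 'k::field_char_0) set" where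
  "G_space n r =
     {p. Poly_Mapping.keys p \<subseteq> {s. length s = n \<and> set s \<subseteq> {0, 1} \<and> count_list s 1 = r}}"

definition G_inv :: "'a indep_struct \<Rightarrow> (nat list \<Rightarrow>\<^sub>0 'k::field_char_0)" where
  "G_inv M = (\<Sum>\<pi> \<in> permutations_of_set (ground M). Poly_Mapping.single (rank_seq M \<pi>) 1)"

context matroid
begin

lemma finite_indeps: "finite (indeps M)"
  by (rule finite_subset[of _ "Pow (ground M)"]) (use indeps_subset finite_ground in auto)

lemma card_le_rk: "I \<in> indeps M \<Longrightarrow> I \<subseteq> X \<Longrightarrow> card I \<le> rk M X"
  unfolding rk_def using finite_indeps by (intro Max_ge) auto

lemma rk_witness:
  obtains I where "I \<in> indeps M" "I \<subseteq> X" "card I = rk M X"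
proof -
  have "Max (card ` {I \<in> indeps M. I \<subseteq> X}) \<in> card ` {I \<in> indeps M. I \<subseteq> X}"
    using finite_indeps empty_indep by (intro Max_in) auto
  then show ?thesis
    using that unfolding rk_def by auto
qed

lemma rk_mono: "X \<subseteq> Y \<Longrightarrow> rk M X \<le> rk M Y"
  by (metis rk_witness card_le_rk order_trans)

lemma rk_empty: "rk M {} = 0"
  by (metis rk_witness card.empty subset_empty)

lemma rk_insert_le: "rk M (insert x X) \<le> Suc (rk M X)"
proof -
  obtain I where I: "I \<in> indeps M" "I \<subseteq> insert x X" "card I = rk M (insert x X)"
    by (rule rk_witness)
  have "I - {x} \<in> indeps M" "I - {x} \<subseteq> X"
    using I indep_mono by blast+
  then have "card (I - {x}) \<le> rk M X"
    by (rule card_le_rk)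
  moreover have "card I \<le> Suc (card (I - {x}))"
    by (metis card_Diff1_le card_Suc_Diff1 card.infinite finite_Diff2 finite.emptyI
        finite.insertI Diff_insert_absorb Diff_empty Diff_insert0 le_SucI order_refl zero_le)
  ultimately show ?thesis
    using I by linarith
qed

lemma rank_seq_binary: "set (rank_seq M xs) \<subseteq> {0, 1}"
proof -
  have "rk M (set (take (Suc j) xs)) - rk M (set (take j xs)) \<in> {0, 1}"
    if "j < length xs" for j
    using rk_insert_le[of "xs ! j" "set (take j xs)"] that
    by (auto simp: take_Suc_conv_app_nth)
  then show ?thesis
    unfolding rank_seq_def set_map by (intro image_subsetI) simp
qed

lemma sum_list_rank_seq: "sum_list (rank_seq M xs) = rk M (set xs)"
proof -
  have "(\<Sum>j<n. rk M (set (take (Suc j) xs)) - rk M (set (take j xs))) = rk M (set (take n xs))"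
    for n
  proof (induction n)
    case 0
    show ?case by (simp add: rk_empty)
  next
    case (Suc n)
    have "rk M (set (take n xs)) \<le> rk M (set (take (Suc n) xs))"
      by (intro rk_mono set_take_subset_set_take) simp
    with Suc show ?case by simp
  qed
  from this[of "length xs"] show ?thesis
    by (simp add: rank_seq_def interv_sum_list_conv_sum_set_nat atLeast0LessThan)
qed

lemma G_inv_in_G_space:
  "(G_inv M :: nat list \<Rightarrow>\<^sub>0 'k::field_char_0) \<in> G_space (card (ground M)) (rk M (ground M))"
proof -
  have count: "count_list s 1 = sum_list s" if "set s \<subseteq> {0, 1}" for s :: "nat list"
    using that by (induction s) auto
  have "rank_seq M \<pi> \<in> {s. length s = card (ground M) \<and> set s \<subseteq> {0, 1} \<and>
      count_list s 1 = rk M (ground M)}"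
    if "\<pi> \<in> permutations_of_set (ground M)" for \<pi>
  proof -
    have "length (rank_seq M \<pi>) = card (ground M)"
      using that distinct_card[of \<pi>] by (simp add: rank_seq_def permutations_of_set_def)
    moreover have "set \<pi> = ground M"
      using that by (simp add: permutations_of_set_def)
    ultimately show ?thesis
      using rank_seq_binary[of \<pi>] count[OF rank_seq_binary[of \<pi>]] sum_list_rank_seq[of \<pi>]
      by auto
  qed
  moreover have "Poly_Mapping.keys (G_inv M :: nat list \<Rightarrow>\<^sub>0 'k) \<subseteq>
      (\<Union>\<pi> \<in> permutations_of_set (ground M).
        Poly_Mapping.keys (Poly_Mapping.single (rank_seq M \<pi>) (1::'k)))"
    unfolding G_inv_def by (rule Poly_Mapping.keys_sum)
  ultimately show ?thesis
    unfolding G_space_def by fastforce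
qed

end

end

theory Submission
  imports Defs
begin

text \<open>
  If \<open>X\<close> is a pinchpoint, it is the only set of rank \<open>r(X)\<close> with at least \<open>|X|\<close> elements. So \<open>|X|\<close>
  is the size of the largest sets of rank \<open>r(X)\<close>, and the permutations whose rank sequence has
  \<open>r(X)\<close> ones among its first \<open>|X|\<close> entries are those that list \<open>X\<close> first; their rank sequences
  are the concatenations of rank sequences of \<open>M|X\<close> with rank sequences of \<open>M/X\<close>, and summing
  out one half recovers the G-invariant of the other factor.

  If \<open>M'\<close> has the same G-invariant as such an \<open>M\<close>, then it has a unique set \<open>X'\<close> of the same
  size and rank, and the minors at \<open>X\<close> and \<open>X'\<close> have equal G-invariants. Every basis of \<open>M'\<close> is
  a basis of the free product of \<open>M'|X'\<close> and \<open>M'/X'\<close>. The number of bases of a free product is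
  determined by the G-invariants of its factors, so both matroids have as many bases as \<open>M\<close>,
  and they coincide.
\<close>

section \<open>Rank, closure and minors\<close>

context matroid
begin

lemma finite_indep: "I \<in> indeps M \<Longrightarrow> finite I"
  using indeps_subset finite_ground finite_subset by blast

lemma rk_le_card: "finite X \<Longrightarrow> rk M X \<le> card X"
  by (metis rk_witness card_mono)

lemma indep_iff_rk: "I \<in> indeps M \<longleftrightarrow> I \<subseteq> ground M \<and> rk M I = card I"
proof
  assume "I \<in> indeps M"
  then show "I \<subseteq> ground M \<and> rk M I = card I"
    using indeps_subset card_le_rk rk_le_card finite_indep by (meson le_antisym subset_refl)
next
  assume I: "I \<subseteq> ground M \<and> rk M I = card I"
  then have "finite I"
    using finite_ground finite_subset by blast
  then show "I \<in> indeps M"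
    by (metis I rk_witness card_subset_eq)
qed

text \<open>A largest independent set between \<open>I\<close> and \<open>A\<close> has size
  \<open>rk M A\<close>: otherwise an independent subset of \<open>A\<close> of that size would
  augment it inside \<open>A\<close>.\<close>

lemma indep_extend:
  assumes "I \<in> indeps M" "I \<subseteq> A"
  obtains J where "J \<in> indeps M" "I \<subseteq> J" "J \<subseteq> A" "card J = rk M A"
proof -
  define S where "S = {J \<in> indeps M. I \<subseteq> J \<and> J \<subseteq> A}"
  have S: "finite S" "S \<noteq> {}"
    using finite_indeps assms by (auto simp: S_def)
  then have "Max (card ` S) \<in> card ` S"
    by simp
  then obtain J where J: "J \<in> S" "card J = Max (card ` S)"
    by auto
  have "card J = rk M A"
  proof (rule ccontr)
    assume "card J \<noteq> rk M A"
    then have less: "card J < rk M A"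
      using card_le_rk[of J A] J(1) by (simp add: S_def)
    obtain K where K: "K \<in> indeps M" "K \<subseteq> A" "card K = rk M A"
      by (rule rk_witness)
    obtain x where x: "x \<in> K - J" "insert x J \<in> indeps M"
      using indep_augment[of J K] J K less by (auto simp: S_def)
    then have "insert x J \<in> S"
      using J K by (auto simp: S_def)
    then have "card (insert x J) \<le> card J"
      using S J by simp
    then show False
      using x J finite_indep by (auto simp: S_def)
  qed
  then show ?thesis
    using that J by (auto simp: S_def)
qed

text \<open>Monotonicity of closure. If \<open>x\<close> raised the rank of \<open>B\<close>, a
  basis \<open>I\<close> of \<open>A\<close> extended to a basis \<open>J\<close> of
  \<open>insert x B\<close> would have to pick up \<open>x\<close>, and then
  \<open>insert x I\<close> would be an independent set too large for
  \<open>insert x A\<close>.\<close>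

lemma rk_insert_absorb_mono:
  assumes "rk M (insert x A) = rk M A" "A \<subseteq> B"
  shows "rk M (insert x B) = rk M B"
proof (rule ccontr)
  assume "rk M (insert x B) \<noteq> rk M B"
  then have less: "rk M B < rk M (insert x B)"
    using rk_mono[OF subset_insertI, of B x] by simp
  obtain I where I: "I \<in> indeps M" "I \<subseteq> A" "card I = rk M A"
    by (rule rk_witness)
  obtain J where J: "J \<in> indeps M" "I \<subseteq> J" "J \<subseteq> insert x B" "card J = rk M (insert x B)"
    using indep_extend[of I "insert x B"] I assms(2) by blast
  have "x \<in> J"
    using J less card_le_rk[of J B] by (metis leD subset_insert)
  moreover have "x \<notin> B"
    using less by (auto simp: insert_absorb)
  ultimately have "insert x I \<in> indeps M" "x \<notin> I"
    using J I assms(2) indep_mono[of J "insert x I"] by auto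
  then have "Suc (rk M A) \<le> rk M (insert x A)"
    using card_le_rk[of "insert x I" "insert x A"] I finite_indep[OF I(1)] by auto
  then show False
    using assms(1) by simp
qed

text \<open>Were the rank to grow, augmentation would add some \<open>x\<close> of
  \<open>A \<union> B\<close> to a basis of \<open>A\<close>, and this single \<open>x\<close> would
  already raise the rank of \<open>A\<close>.\<close>

lemma rk_Un_absorb:
  assumes "\<And>x. x \<in> B \<Longrightarrow> rk M (insert x A) = rk M A"
  shows "rk M (A \<union> B) = rk M A"
proof (rule ccontr)
  assume "rk M (A \<union> B) \<noteq> rk M A"
  then have less: "rk M A < rk M (A \<union> B)"
    using rk_mono[of A "A \<union> B"] by auto
  obtain I where I: "I \<in> indeps M" "I \<subseteq> A" "card I = rk M A"
    by (rule rk_witness)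
  obtain J where J: "J \<in> indeps M" "J \<subseteq> A \<union> B" "card J = rk M (A \<union> B)"
    by (rule rk_witness)
  obtain x where x: "x \<in> J - I" "insert x I \<in> indeps M"
    using indep_augment[of I J] I J less by auto
  have "Suc (rk M A) \<le> rk M (insert x A)"
    using card_le_rk[of "insert x I" "insert x A"] I x finite_indep[OF I(1)] by auto
  moreover have "rk M (insert x A) = rk M A"
    using x J assms by (cases "x \<in> A") (auto simp: insert_absorb)
  ultimately show False
    by simp
qed

lemma rk_Un_le: "finite B \<Longrightarrow> rk M (A \<union> B) \<le> rk M A + card B"
proof (induction B rule: finite_induct)
  case (insert x B)
  then show ?case
    using rk_insert_le[of x "A \<union> B"] by auto
qed simp

section \<open>Circuits, closure and cyclic flats\<close>

lemma circuit_subset: "C \<in> circuits M \<Longrightarrow> C \<subseteq> ground M"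
  and circuit_dep: "C \<in> circuits M \<Longrightarrow> C \<notin> indeps M"
  and circuit_psubset_indep: "C \<in> circuits M \<Longrightarrow> D \<subset> C \<Longrightarrow> D \<in> indeps M"
  by (auto simp: circuits_def)

lemma dep_contains_circuit:
  assumes "D \<subseteq> ground M" "D \<notin> indeps M"
  obtains C where "C \<in> circuits M" "C \<subseteq> D"
proof -
  have "finite D"
    using assms finite_ground finite_subset by blast
  then have "\<exists>C\<in>circuits M. C \<subseteq> D"
    using assms
  proof (induction D rule: finite_psubset_induct)
    case (psubset D)
    show ?case
    proof (cases "\<exists>D'. D' \<subset> D \<and> D' \<notin> indeps M")
      case True
      then obtain D' where D': "D' \<subset> D" "D' \<notin> indeps M"
        by blast
      then have "\<exists>C\<in>circuits M. C \<subseteq> D'"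
        using psubset by blast
      then show ?thesis
        using D' by blast
    next
      case False
      then have "D \<in> circuits M"
        using psubset by (auto simp: circuits_def)
      then show ?thesis
        by blast
    qed
  qed
  then show ?thesis
    using that by blast
qed

lemma rk_circuit_remove:
  assumes "C \<in> circuits M" "x \<in> C"
  shows "rk M (C - {x}) = rk M C"
proof -
  have fin: "finite C"
    using circuit_subset[OF assms(1)] finite_ground finite_subset by blast
  have "C - {x} \<in> indeps M"
    using circuit_psubset_indep assms by blast
  then have "rk M (C - {x}) = card C - 1"
    using indep_iff_rk assms fin by auto
  moreover have "rk M C \<noteq> card C"
    using circuit_dep circuit_subset indep_iff_rk assms by blast
  then have "rk M C < card C"
    using rk_le_card[OF fin] by simp
  ultimately show ?thesis
    using rk_mono[of "C - {x}" C] by auto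
qed

text \<open>The closure operator; \<open>cl {}\<close> is the set of loops.\<close>

definition cl :: "'a set \<Rightarrow> 'a set" where
  "cl A = {x \<in> ground M. rk M (insert x A) = rk M A}"

lemma subset_cl: "A \<subseteq> ground M \<Longrightarrow> A \<subseteq> cl A"
  by (auto simp: cl_def insert_absorb)

lemma cl_subset_ground: "cl A \<subseteq> ground M"
  by (auto simp: cl_def)

lemma rk_Un_cl: "A \<subseteq> B \<Longrightarrow> rk M (B \<union> cl A) = rk M B"
  by (rule rk_Un_absorb) (simp add: cl_def rk_insert_absorb_mono[of _ A B])

lemma rk_cl: "A \<subseteq> ground M \<Longrightarrow> rk M (cl A) = rk M A"
  using rk_Un_cl[of A A] subset_cl[of A] by (simp add: Un_absorb1)

lemma flat_cl:
  assumes "A \<subseteq> ground M"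
  shows "cl A \<in> flats M"
proof -
  have "rk M (cl A) < rk M (insert x (cl A))" if "x \<in> ground M - cl A" for x
  proof -
    have "rk M (insert x A) \<noteq> rk M A"
      using that by (auto simp: cl_def)
    then have "rk M A < rk M (insert x A)"
      using rk_mono[OF subset_insertI, of A x] by simp
    also have "\<dots> \<le> rk M (insert x (cl A))"
      using subset_cl[OF assms] by (intro rk_mono) auto
    finally show ?thesis
      using rk_cl[OF assms] by simp
  qed
  then show ?thesis
    using cl_subset_ground by (auto simp: flats_def)
qed

text \<open>Adding \<open>x\<close> to a basis \<open>I\<close> of \<open>A\<close> gives a
  dependent set, and since \<open>I\<close> is independent, any circuit inside that set must use
  \<open>x\<close>.\<close>

lemma fundamental_circuit:
  assumes "A \<subseteq> ground M" "x \<in> cl A" "x \<notin> A"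
  obtains C where "C \<in> circuits M" "x \<in> C" "C \<subseteq> insert x A"
proof -
  obtain I where I: "I \<in> indeps M" "I \<subseteq> A" "card I = rk M A"
    by (rule rk_witness)
  have "insert x I \<notin> indeps M"
  proof
    assume "insert x I \<in> indeps M"
    then have "card (insert x I) \<le> rk M (insert x A)"
      using I by (intro card_le_rk) auto
    then show False
      using I assms finite_indep[OF I(1)] by (auto simp: cl_def card_insert_if split: if_splits)
  qed
  moreover have "insert x I \<subseteq> ground M"
    using I assms cl_subset_ground by blast
  ultimately obtain C where C: "C \<in> circuits M" "C \<subseteq> insert x I"
    by (meson dep_contains_circuit)
  moreover have "x \<in> C"
    using C I indep_mono circuit_dep by blast
  ultimately show ?thesis
    using that I by blast
qed

text \<open>Each element that closure adds lies on a fundamental circuit whose other elements are in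
  the union, so the closure is again covered by circuits that it contains.\<close>

lemma cyclic_flat_cl_Union:
  assumes "\<C> \<subseteq> circuits M"
  shows "cl (\<Union>\<C>) \<in> cyclic_flats M"
proof -
  have sub: "\<Union>\<C> \<subseteq> ground M"
    using assms circuit_subset by blast
  have "\<exists>D\<in>circuits M. x \<in> D \<and> D \<subseteq> cl (\<Union>\<C>)" if x: "x \<in> cl (\<Union>\<C>)" for x
  proof (cases "x \<in> \<Union>\<C>")
    case True
    then obtain D where "D \<in> \<C>" "x \<in> D"
      by blast
    then show ?thesis
      using assms subset_cl[OF sub] by (meson Union_upper order_trans subsetD)
  next
    case False
    obtain D where "D \<in> circuits M" "x \<in> D" "D \<subseteq> insert x (\<Union>\<C>)"
      by (rule fundamental_circuit[OF sub x False])
    then show ?thesis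
      using subset_cl[OF sub] x by (meson insert_subset order_trans)
  qed
  then have "cl (\<Union>\<C>) \<subseteq> \<Union>{D \<in> circuits M. D \<subseteq> cl (\<Union>\<C>)}"
    by (intro subsetI) (simp add: conj_ac Bex_def)
  then have "cl (\<Union>\<C>) = \<Union>{D \<in> circuits M. D \<subseteq> cl (\<Union>\<C>)}"
    by (intro equalityI Union_least) simp_all
  moreover have "{D \<in> circuits M. D \<subseteq> cl (\<Union>\<C>)} \<subseteq> circuits M"
    by simp
  ultimately show ?thesis
    using flat_cl[OF sub] unfolding cyclic_flats_def by blast
qed

lemma rk_singleton_circuit:
  assumes "C \<in> circuits M" "2 \<le> card C" "x \<in> C"
  shows "rk M {x} = 1"
proof -
  have "{x} \<subset> C"
    using assms by (auto simp: psubset_eq)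
  then have "{x} \<in> indeps M"
    using circuit_psubset_indep assms(1) by blast
  then show ?thesis
    by (simp add: indep_iff_rk)
qed

text \<open>The least cyclic flat is \<open>cl {}\<close>. It is the only one if every circuit is a
  loop, while a circuit \<open>C\<close> with two or more elements consists of non-loops, so that
  \<open>cl C\<close> is a second one. This is the form in which properness of a factor is used and
  verified.\<close>

lemma two_cyclic_flats_iff:
  "2 \<le> card (cyclic_flats M) \<longleftrightarrow> (\<exists>C\<in>circuits M. 2 \<le> card C)"
proof
  assume two: "2 \<le> card (cyclic_flats M)"
  show "\<exists>C\<in>circuits M. 2 \<le> card C"
  proof (rule ccontr)
    assume *: "\<not> (\<exists>C\<in>circuits M. 2 \<le> card C)"
    have "F = cl {}" if F: "F \<in> cyclic_flats M" for F
    proof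
      obtain \<C> where \<C>: "\<C> \<subseteq> circuits M" "F = \<Union>\<C>"
        using F by (auto simp: cyclic_flats_def)
      show "F \<subseteq> cl {}"
      proof
        fix x assume "x \<in> F"
        then obtain C where C: "C \<in> circuits M" "x \<in> C"
          using \<C> by blast
        then have "finite C" "card C \<le> 1"
          using * finite_ground circuit_subset finite_subset[of C] by force+
        then have "C = {x}"
          using C(2) by (auto simp: card_le_Suc0_iff_eq)
        then show "x \<in> cl {}"
          using C circuit_subset rk_circuit_remove[of C x] by (auto simp: cl_def)
      qed
      show "cl {} \<subseteq> F"
      proof
        fix x assume x: "x \<in> cl {}"
        then have "rk M (insert x F) = rk M F" "x \<in> ground M"
          using rk_insert_absorb_mono[of x "{}" F] by (auto simp: cl_def)
        then show "x \<in> F"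
          using F unfolding cyclic_flats_def flats_def
          by (metis (no_types, lifting) DiffI less_irrefl mem_Collect_eq)
      qed
    qed
    then have "cyclic_flats M \<subseteq> {cl {}}"
      by blast
    then have "card (cyclic_flats M) \<le> 1"
      using card_mono[of "{cl {}}"] by simp
    then show False
      using two by simp
  qed
next
  assume "\<exists>C\<in>circuits M. 2 \<le> card C"
  then obtain C where C: "C \<in> circuits M" "2 \<le> card C"
    by blast
  then obtain x where x: "x \<in> C"
    by fastforce
  have "x \<in> cl C"
    using x subset_cl circuit_subset C by blast
  moreover have "x \<notin> cl {}"
    using rk_singleton_circuit[OF C x] by (simp add: cl_def rk_empty)
  ultimately have "cl {} \<noteq> cl C"
    by blast
  then have "card {cl {}, cl C} = 2"
    by simp
  moreover have "{cl {}, cl C} \<subseteq> cyclic_flats M"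
    using cyclic_flat_cl_Union[of "{}"] cyclic_flat_cl_Union[of "{C}"] C by simp
  moreover have "finite (cyclic_flats M)"
    by (rule finite_subset[of _ "Pow (ground M)"])
      (use finite_ground in \<open>auto simp: cyclic_flats_def flats_def\<close>)
  ultimately show "2 \<le> card (cyclic_flats M)"
    by (metis card_mono)
qed

section \<open>Restriction and contraction\<close>

lemma matroid_restriction:
  assumes "X \<subseteq> ground M"
  shows "matroid (restriction M X)"
proof
  show "finite (ground (restriction M X))"
    using finite_subset[OF assms finite_ground] by (simp add: restriction_def)
  show "{} \<in> indeps (restriction M X)"
    using empty_indep by (simp add: restriction_def)
  fix I J
  show "I \<subseteq> ground (restriction M X)" if "I \<in> indeps (restriction M X)"
    using that by (simp add: restriction_def)
  show "J \<in> indeps (restriction M X)" if "I \<in> indeps (restriction M X)" "J \<subseteq> I"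
    using that indep_mono[of I J] by (auto simp: restriction_def)
  assume IJ: "I \<in> indeps (restriction M X)" "J \<in> indeps (restriction M X)" "card I < card J"
  then obtain x where "x \<in> J - I" "insert x I \<in> indeps M"
    using indep_augment[of I J] by (auto simp: restriction_def)
  then show "\<exists>x\<in>J - I. insert x I \<in> indeps (restriction M X)"
    using IJ by (auto simp: restriction_def)
qed

lemma rk_restriction: "Y \<subseteq> X \<Longrightarrow> rk (restriction M X) Y = rk M Y"
  unfolding rk_def restriction_def
  by (rule arg_cong[of _ _ "\<lambda>S. Max (card ` S)"]) auto

text \<open>Every element of \<open>X\<close> lies in the closure of its basis \<open>B\<close>, so
  joining \<open>X\<close> or \<open>B\<close> to \<open>I\<close> gives the same rank. Independence
  in the contraction thus becomes independence in \<open>M\<close>, for any fixed choice of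
  \<open>B\<close>.\<close>

lemma contraction_indep_iff:
  assumes "B \<in> indeps M" "B \<subseteq> X" "card B = rk M X" "I \<inter> X = {}"
  shows "I \<in> indeps (contraction M X) \<longleftrightarrow> I \<union> B \<in> indeps M"
proof -
  have *: "rk M (I \<union> B) = rk M (I \<union> X)"
  proof -
    have "rk M (insert x B) = rk M B" if "x \<in> X" for x
    proof -
      have "rk M (insert x B) \<le> rk M X"
        using assms that by (intro rk_mono) auto
      moreover have "rk M B = rk M X"
        using assms indep_iff_rk by auto
      ultimately show ?thesis
        using rk_mono[OF subset_insertI, of B x] by simp
    qed
    then have "rk M ((I \<union> B) \<union> X) = rk M (I \<union> B)"
      by (intro rk_Un_absorb) (auto intro: rk_insert_absorb_mono)
    moreover have "(I \<union> B) \<union> X = I \<union> X"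
      using assms by blast
    ultimately show ?thesis
      by simp
  qed
  have "card (I \<union> B) = card I + rk M X" if "I \<subseteq> ground M"
    using that assms finite_indep[OF assms(1)] finite_ground
    by (subst card_Un_disjoint) (auto intro: finite_subset)
  moreover have "B \<subseteq> ground M"
    using assms indeps_subset by blast
  moreover have "I \<subseteq> ground M - X \<longleftrightarrow> I \<subseteq> ground M"
    using assms(4) by blast
  ultimately show ?thesis
    by (cases "I \<subseteq> ground M") (simp_all add: indep_iff_rk contraction_def *)
qed

lemma matroid_contraction: "matroid (contraction M X)"
proof -
  obtain B where B: "B \<in> indeps M" "B \<subseteq> X" "card B = rk M X"
    by (rule rk_witness)
  note iff = contraction_indep_iff[OF B]
  have disj: "I \<inter> X = {}" "I \<subseteq> ground M" if "I \<in> indeps (contraction M X)" for I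
    using that by (auto simp: contraction_def)
  show ?thesis
  proof
    show "finite (ground (contraction M X))"
      using finite_ground by (simp add: contraction_def)
    show "I \<subseteq> ground (contraction M X)" if "I \<in> indeps (contraction M X)" for I
      using that by (simp add: contraction_def)
    show "{} \<in> indeps (contraction M X)"
      by (simp add: contraction_def)
    show "J \<in> indeps (contraction M X)" if "I \<in> indeps (contraction M X)" "J \<subseteq> I" for I J
    proof -
      have "I \<union> B \<in> indeps M"
        using that iff disj by blast
      then have "J \<union> B \<in> indeps M"
        using that by (auto intro: indep_mono)
      then show ?thesis
        using that disj[of I] iff[of J] by blast
    qed
    show "\<exists>x\<in>J - I. insert x I \<in> indeps (contraction M X)"
      if "I \<in> indeps (contraction M X)" "J \<in> indeps (contraction M X)" "card I < card J" for I J
    proof -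
      note IJ = disj[OF that(1)] disj[OF that(2)]
      have "finite I" "finite J" "finite B"
        using IJ finite_ground finite_subset finite_indep B by blast+
      then have "card (I \<union> B) < card (J \<union> B)"
        using IJ B(2) that(3) by (subst (1 2) card_Un_disjoint) auto
      moreover have "I \<union> B \<in> indeps M" "J \<union> B \<in> indeps M"
        using iff that IJ by blast+
      \<comment> \<open>\<open>B\<close> lies in both sets, so the new element comes from
        \<open>J - I\<close>.\<close>
      ultimately obtain x where x: "x \<in> (J \<union> B) - (I \<union> B)" "insert x (I \<union> B) \<in> indeps M"
        using indep_augment by blast
      then have "insert x I \<in> indeps (contraction M X)"
        using iff[of "insert x I"] IJ by auto
      then show ?thesis
        using x by blast
    qed
  qed
qed

lemma rk_contraction:
  assumes "X \<subseteq> ground M" "Y \<subseteq> ground M - X"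
  shows "rk (contraction M X) Y = rk M (Y \<union> X) - rk M X"
proof -
  interpret C: matroid "contraction M X"
    by (rule matroid_contraction)
  obtain B where B: "B \<in> indeps M" "B \<subseteq> X" "card B = rk M X"
    by (rule rk_witness)
  \<comment> \<open>A basis \<open>K\<close> of \<open>Y \<union> X\<close> that extends the basis
    \<open>B\<close> of \<open>X\<close> meets \<open>X\<close> in exactly \<open>B\<close>, so
    \<open>K - X\<close> is independent in the contraction and attains the rank difference.\<close>
  obtain K where K: "K \<in> indeps M" "B \<subseteq> K" "K \<subseteq> Y \<union> X" "card K = rk M (Y \<union> X)"
    using indep_extend[of B "Y \<union> X"] B by blast
  have "K \<inter> X \<in> indeps M"
    using K indep_mono by blast
  then have "card (K \<inter> X) \<le> card B" "finite (K \<inter> X)"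
    using B card_le_rk[of "K \<inter> X" X] finite_indep by auto
  then have KX: "B = K \<inter> X"
    using B K by (intro card_seteq) auto
  then have "(K - X) \<union> B = K"
    by blast
  then have "K - X \<in> indeps (contraction M X)"
    using contraction_indep_iff[OF B, of "K - X"] K by auto
  then have "card (K - X) \<le> rk (contraction M X) Y"
    using K by (intro C.card_le_rk) auto
  moreover have "card (K - X) = rk M (Y \<union> X) - rk M X"
    using KX K B finite_indep by (metis card_Diff_subset_Int)
  moreover obtain I where I: "I \<in> indeps (contraction M X)" "I \<subseteq> Y"
      "card I = rk (contraction M X) Y"
    by (rule C.rk_witness)
  moreover have "rk M (I \<union> X) \<le> rk M (Y \<union> X)"
    using I by (intro rk_mono) auto
  ultimately show ?thesis
    by (auto simp: contraction_def)
qed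

end

section \<open>Counting rank sequences\<close>

text \<open>With the predicate \<open>\<lambda>w. w = u\<close> this is the coefficient of
  \<open>u\<close> in the G-invariant; a general predicate gives a sum of coefficients, as a natural
  number and without reference to a field.\<close>

definition seq_count :: "'a indep_struct \<Rightarrow> (nat list \<Rightarrow> bool) \<Rightarrow> nat" where
  "seq_count M P = card {\<pi> \<in> permutations_of_set (ground M). P (rank_seq M \<pi>)}"

lemma lookup_G_inv:
  "Poly_Mapping.lookup (G_inv M :: nat list \<Rightarrow>\<^sub>0 'k::field_char_0) u =
    of_nat (seq_count M (\<lambda>w. w = u))"
proof -
  have "Poly_Mapping.lookup (G_inv M :: nat list \<Rightarrow>\<^sub>0 'k) u =
      (\<Sum>\<pi>\<in>permutations_of_set (ground M). if rank_seq M \<pi> = u then 1 else 0)"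
    by (simp add: G_inv_def lookup_sum lookup_single when_def)
  also have "\<dots> = (\<Sum>\<pi>\<in>{\<pi> \<in> permutations_of_set (ground M). rank_seq M \<pi> = u}. 1)"
    by (rule sum.inter_filter[symmetric]) simp
  finally show ?thesis
    by (simp add: seq_count_def)
qed

text \<open>Permutations are grouped by rank sequence. \<open>S\<close> may contain sequences that
  do not occur, so that one index set can serve two matroids.\<close>

lemma seq_count_eq_sum:
  assumes "finite S" "rank_seq M ` permutations_of_set (ground M) \<subseteq> S"
  shows "seq_count M P = (\<Sum>u\<in>{u \<in> S. P u}. seq_count M (\<lambda>w. w = u))"
proof -
  let ?A = "{\<pi> \<in> permutations_of_set (ground M). P (rank_seq M \<pi>)}"
  have "(\<Sum>u\<in>{u \<in> S. P u}. seq_count M (\<lambda>w. w = u)) =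
      (\<Sum>u\<in>{u \<in> S. P u}. \<Sum>\<pi>\<in>{\<pi> \<in> ?A. rank_seq M \<pi> = u}. 1)"
    by (intro sum.cong) (auto simp: seq_count_def intro!: arg_cong[of _ _ card])
  also have "\<dots> = (\<Sum>\<pi>\<in>?A. 1)"
    using assms by (intro sum.group) auto
  finally show ?thesis
    by (simp add: seq_count_def)
qed

text \<open>Coefficients determine the counts because \<open>of_nat\<close> is injective in
  characteristic zero; equality tests as predicates give back the coefficients.\<close>

lemma G_inv_eq_iff:
  "(G_inv M :: nat list \<Rightarrow>\<^sub>0 'k::field_char_0) = G_inv M' \<longleftrightarrow>
    (\<forall>P. seq_count M P = seq_count M' P)"
proof
  assume eq: "(G_inv M :: nat list \<Rightarrow>\<^sub>0 'k) = G_inv M'"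
  have single: "seq_count M (\<lambda>w. w = u) = seq_count M' (\<lambda>w. w = u)" for u
    using lookup_G_inv[where 'k = 'k, of M u] lookup_G_inv[where 'k = 'k, of M' u] eq by simp
  let ?S = "rank_seq M ` permutations_of_set (ground M) \<union>
    rank_seq M' ` permutations_of_set (ground M')"
  show "\<forall>P. seq_count M P = seq_count M' P"
  proof
    fix P
    have "seq_count M P = (\<Sum>u\<in>{u \<in> ?S. P u}. seq_count M (\<lambda>w. w = u))"
      by (rule seq_count_eq_sum) auto
    also have "\<dots> = (\<Sum>u\<in>{u \<in> ?S. P u}. seq_count M' (\<lambda>w. w = u))"
      by (simp only: single)
    also have "\<dots> = seq_count M' P"
      by (rule seq_count_eq_sum[symmetric]) auto
    finally show "seq_count M P = seq_count M' P" .
  qed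
next
  assume "\<forall>P. seq_count M P = seq_count M' P"
  then show "(G_inv M :: nat list \<Rightarrow>\<^sub>0 'k) = G_inv M'"
    by (intro poly_mapping_eqI) (simp add: lookup_G_inv)
qed

section \<open>Rank sequences of prefixes and of concatenations\<close>

lemma length_rank_seq [simp]: "length (rank_seq M xs) = length xs"
  by (simp add: rank_seq_def)

lemma take_rank_seq: "take j (rank_seq M xs) = rank_seq M (take j xs)"
proof (rule nth_equalityI)
  fix i assume "i < length (take j (rank_seq M xs))"
  then show "take j (rank_seq M xs) ! i = rank_seq M (take j xs) ! i"
    by (simp add: rank_seq_def min_absorb1 Suc_leI)
qed simp

lemma card_bij_betw_filter:
  assumes "bij_betw f A B"
  shows "card {x \<in> A. P (f x)} = card {y \<in> B. P y}"
proof -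
  have "f ` {x \<in> A. P (f x)} = {y \<in> B. P y}"
    using bij_betw_imp_surj_on[OF assms] by blast
  moreover have "inj_on f {x \<in> A. P (f x)}"
    using bij_betw_imp_inj_on[OF assms] by (rule inj_on_subset) simp
  ultimately show ?thesis
    using card_image by fastforce
qed

lemma bij_betw_append_permutations:
  assumes "finite E" "X \<subseteq> E"
  shows "bij_betw (\<lambda>(\<sigma>, \<tau>). \<sigma> @ \<tau>) (permutations_of_set X \<times> permutations_of_set (E - X))
    {\<pi> \<in> permutations_of_set E. set (take (card X) \<pi>) = X}"
proof (rule bij_betwI[where g = "\<lambda>\<pi>. (take (card X) \<pi>, drop (card X) \<pi>)"])
  have len: "length \<sigma> = card X" if "\<sigma> \<in> permutations_of_set X" for \<sigma>
    using that distinct_card[of \<sigma>] by (auto simp: permutations_of_set_def)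
  then show "(\<lambda>(\<sigma>, \<tau>). \<sigma> @ \<tau>) \<in> permutations_of_set X \<times> permutations_of_set (E - X) \<rightarrow>
      {\<pi> \<in> permutations_of_set E. set (take (card X) \<pi>) = X}"
    using assms by (auto simp: permutations_of_set_def)
  show "(\<lambda>\<pi>. (take (card X) \<pi>, drop (card X) \<pi>)) \<in>
      {\<pi> \<in> permutations_of_set E. set (take (card X) \<pi>) = X} \<rightarrow>
      permutations_of_set X \<times> permutations_of_set (E - X)"
  proof (intro funcsetI)
    fix \<pi> assume "\<pi> \<in> {\<pi> \<in> permutations_of_set E. set (take (card X) \<pi>) = X}"
    then have \<pi>: "set \<pi> = E" "distinct \<pi>" "set (take (card X) \<pi>) = X"
      by (auto simp: permutations_of_set_def)
    have "set \<pi> = set (take (card X) \<pi>) \<union> set (drop (card X) \<pi>)"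
      by (metis append_take_drop_id set_append)
    moreover have "set (take (card X) \<pi>) \<inter> set (drop (card X) \<pi>) = {}"
      by (rule set_take_disj_set_drop_if_distinct[OF \<pi>(2)]) simp
    ultimately show "(take (card X) \<pi>, drop (card X) \<pi>) \<in>
        permutations_of_set X \<times> permutations_of_set (E - X)"
      using \<pi> by (auto simp: permutations_of_set_def)
  qed
qed (use assms in \<open>auto simp: permutations_of_set_def distinct_card\<close>)

text \<open>Each \<open>A\<close> in the family is listed first by
  \<open>fact j * fact (card E - j)\<close> permutations, one for each pair of orderings of
  \<open>A\<close> and of its complement.\<close>

lemma card_permutations_prefix:
  assumes "finite E" "\<A> \<subseteq> {A. A \<subseteq> E \<and> card A = j}"
  shows "card {\<pi> \<in> permutations_of_set E. set (take j \<pi>) \<in> \<A>} =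
    card \<A> * (fact j * fact (card E - j))"
proof -
  let ?S = "\<lambda>A. {\<pi> \<in> permutations_of_set E. set (take j \<pi>) = A}"
  have fin: "finite \<A>"
    by (rule finite_subset[OF assms(2)]) (use assms(1) in auto)
  have "card (?S A) = fact j * fact (card E - j)" if "A \<in> \<A>" for A
  proof -
    have A: "A \<subseteq> E" "card A = j" "finite A"
      using that assms finite_subset by blast+
    have "card (permutations_of_set A \<times> permutations_of_set (E - A)) =
        fact j * fact (card E - j)"
      using A assms(1) by (simp add: card_cartesian_product card_Diff_subset)
    then show ?thesis
      using bij_betw_same_card[OF bij_betw_append_permutations[OF assms(1) A(1)]] A by simp
  qed
  moreover have "{\<pi> \<in> permutations_of_set E. set (take j \<pi>) \<in> \<A>} = (\<Union>A\<in>\<A>. ?S A)"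
    by blast
  moreover have "card (\<Union>A\<in>\<A>. ?S A) = (\<Sum>A\<in>\<A>. card (?S A))"
    using fin by (intro card_UN_disjoint) auto
  ultimately show ?thesis
    by simp
qed

text \<open>Prefixes inside \<open>\<sigma>\<close> only see subsets of \<open>X\<close>, where
  \<open>M\<close> and the restriction have the same ranks. Later prefixes contain all of
  \<open>X\<close>, and their ranks exceed those in the contraction by the constant
  \<open>rk M X\<close>.\<close>

lemma rank_seq_append:
  assumes "matroid M" "X \<subseteq> ground M" "set \<sigma> = X" "set \<tau> \<subseteq> ground M - X"
  shows "rank_seq M (\<sigma> @ \<tau>) = rank_seq (restriction M X) \<sigma> @ rank_seq (contraction M X) \<tau>"
proof (rule nth_equalityI)
  interpret matroid M
    by fact
  fix i assume "i < length (rank_seq M (\<sigma> @ \<tau>))"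
  then have i: "i < length \<sigma> + length \<tau>"
    by simp
  show "rank_seq M (\<sigma> @ \<tau>) ! i =
      (rank_seq (restriction M X) \<sigma> @ rank_seq (contraction M X) \<tau>) ! i"
  proof (cases "i < length \<sigma>")
    case True
    have "rk (restriction M X) (set (take m \<sigma>)) = rk M (set (take m \<sigma>))" for m
      using assms(3) by (intro rk_restriction) (auto dest: in_set_takeD)
    then show ?thesis
      using True by (simp add: nth_append) (simp add: rank_seq_def)
  next
    case False
    then obtain m where m: "i = length \<sigma> + m" "m < length \<tau>"
      using i by (metis add_less_cancel_left le_iff_add not_less)
    have "rk (contraction M X) (set (take l \<tau>)) = rk M (X \<union> set (take l \<tau>)) - rk M X" for l
      using assms by (subst rk_contraction) (auto dest: in_set_takeD simp: Un_commute)
    \<comment> \<open>Subtraction is truncated; this bound lets the subtracted \<open>rk M X\<close>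
      cancel in each difference.\<close>
    moreover have "rk M X \<le> rk M (X \<union> set (take l \<tau>))" for l
      by (intro rk_mono) auto
    ultimately show ?thesis
      using m assms(3) by (simp add: nth_append) (simp add: rank_seq_def)
  qed
qed simp

context matroid
begin

lemma sum_list_take_rank_seq: "sum_list (take j (rank_seq M xs)) = rk M (set (take j xs))"
  by (simp add: take_rank_seq sum_list_rank_seq)

text \<open>The first \<open>j\<close> entries of a rank sequence sum to the rank of the first
  \<open>j\<close> elements, so this count of permutations is a count of sets, each with the same
  multiplicity.\<close>

lemma seq_count_rank_prefix:
  assumes "j \<le> card (ground M)"
  shows "seq_count M (\<lambda>w. sum_list (take j w) = k) =
    card {A. A \<subseteq> ground M \<and> card A = j \<and> rk M A = k} * (fact j * fact (card (ground M) - j))"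
proof -
  have "set (take j \<pi>) \<subseteq> ground M \<and> card (set (take j \<pi>)) = j"
    if "\<pi> \<in> permutations_of_set (ground M)" for \<pi>
    using that assms set_take_subset[of j \<pi>] length_finite_permutations_of_set[OF that]
    by (auto simp: permutations_of_set_def distinct_card)
  then have "seq_count M (\<lambda>w. sum_list (take j w) = k) = card {\<pi> \<in> permutations_of_set (ground M).
      set (take j \<pi>) \<in> {A. A \<subseteq> ground M \<and> card A = j \<and> rk M A = k}}"
    unfolding seq_count_def sum_list_take_rank_seq by (intro arg_cong[of _ _ card]) blast
  then show ?thesis
    using finite_ground by (subst (asm) card_permutations_prefix) auto
qed

text \<open>By uniqueness, the rank of the first \<open>card X\<close> elements detects whether a
  permutation lists \<open>X\<close> first. Such permutations are arbitrary pairs of orderings of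
  \<open>X\<close> and of its complement, so the count factors.\<close>

lemma seq_count_split:
  assumes "X \<subseteq> ground M"
    and unique: "\<And>A. A \<subseteq> ground M \<Longrightarrow> card A = card X \<Longrightarrow> rk M A = rk M X \<Longrightarrow> A = X"
  shows "seq_count M (\<lambda>w. sum_list (take (card X) w) = rk M X \<and>
      P (take (card X) w) \<and> Q (drop (card X) w)) =
    seq_count (restriction M X) P * seq_count (contraction M X) Q"
proof -
  let ?E = "ground M" and ?s = "card X"
  let ?f = "\<lambda>(\<sigma>, \<tau>). \<sigma> @ \<tau>"
  let ?T = "{\<pi> \<in> permutations_of_set ?E. set (take ?s \<pi>) = X}"
  let ?R = "\<lambda>w. P (take ?s w) \<and> Q (drop ?s w)"
  let ?D = "{\<sigma> \<in> permutations_of_set X. P (rank_seq (restriction M X) \<sigma>)} \<times>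
    {\<tau> \<in> permutations_of_set (?E - X). Q (rank_seq (contraction M X) \<tau>)}"
  have bij: "bij_betw ?f (permutations_of_set X \<times> permutations_of_set (?E - X)) ?T"
    by (rule bij_betw_append_permutations[OF finite_ground assms(1)])
  have len: "length \<sigma> = ?s" if "\<sigma> \<in> permutations_of_set X" for \<sigma>
    using that distinct_card[of \<sigma>] by (auto simp: permutations_of_set_def)
  have "rank_seq M (\<sigma> @ \<tau>) = rank_seq (restriction M X) \<sigma> @ rank_seq (contraction M X) \<tau>"
    if "\<sigma> \<in> permutations_of_set X" "\<tau> \<in> permutations_of_set (?E - X)" for \<sigma> \<tau>
    using that matroid_axioms assms(1) by (intro rank_seq_append) (auto simp: permutations_of_set_def)
  then have "?D = {p \<in> permutations_of_set X \<times> permutations_of_set (?E - X).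
      ?R (rank_seq M (?f p))}"
    using len by (auto simp: case_prod_beta)
  then have "card ?D = card {\<pi> \<in> ?T. ?R (rank_seq M \<pi>)}"
    using card_bij_betw_filter[OF bij, of "\<lambda>\<pi>. ?R (rank_seq M \<pi>)"] by simp
  moreover have "card ?D = seq_count (restriction M X) P * seq_count (contraction M X) Q"
    by (simp add: card_cartesian_product seq_count_def restriction_def contraction_def)
  moreover have "rk M (set (take ?s \<pi>)) = rk M X \<longleftrightarrow> set (take ?s \<pi>) = X"
    if "\<pi> \<in> permutations_of_set ?E" for \<pi>
  proof -
    have "?s \<le> length \<pi>"
      using that card_mono[OF finite_ground assms(1)]
      by (simp add: length_finite_permutations_of_set)
    then show ?thesis
      using unique[of "set (take ?s \<pi>)"] that set_take_subset[of ?s \<pi>]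
      by (auto simp: permutations_of_set_def distinct_card)
  qed
  then have "{\<pi> \<in> permutations_of_set ?E. rk M (set (take ?s \<pi>)) = rk M X \<and> ?R (rank_seq M \<pi>)} =
      {\<pi> \<in> ?T. ?R (rank_seq M \<pi>)}"
    by blast
  ultimately show ?thesis
    unfolding seq_count_def sum_list_take_rank_seq by simp
qed

end

section \<open>Consequences of equal G-invariants\<close>

lemma seq_count_True: "finite (ground M) \<Longrightarrow> seq_count M (\<lambda>_. True) = fact (card (ground M))"
  by (simp add: seq_count_def)

text \<open>The predicate \<open>?P\<close> singles out sequences whose length or sum is wrong for
  \<open>M\<close>. It has count zero in \<open>M\<close>, hence in \<open>M'\<close>, and
  \<open>M'\<close> has at least one permutation to read its own length and sum from.\<close>

lemma seq_count_eq_imp_card_rk_eq: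
  assumes "matroid M" "matroid M'" "\<And>P. seq_count M P = seq_count M' P"
  shows "card (ground M) = card (ground M')" "rk M (ground M) = rk M' (ground M')"
proof -
  interpret M: matroid M by fact
  interpret M': matroid M' by fact
  let ?P = "\<lambda>w. \<not> (length w = card (ground M) \<and> sum_list w = rk M (ground M))"
  have "\<not> ?P (rank_seq M \<pi>)" if "\<pi> \<in> permutations_of_set (ground M)" for \<pi>
    using that length_finite_permutations_of_set[OF that]
    by (simp add: M.sum_list_rank_seq permutations_of_set_def)
  then have "{\<pi> \<in> permutations_of_set (ground M). ?P (rank_seq M \<pi>)} = {}"
    by blast
  then have "seq_count M ?P = 0"
    by (simp only: seq_count_def card.empty)
  then have none: "seq_count M' ?P = 0"
    using assms(3) by simp
  obtain \<pi> where \<pi>: "\<pi> \<in> permutations_of_set (ground M')"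
    using finite_distinct_list[OF M'.finite_ground] by (auto simp: permutations_of_set_def)
  have "\<not> ?P (rank_seq M' \<pi>)"
    using none \<pi> by (auto simp: seq_count_def)
  then show "card (ground M) = card (ground M')" "rk M (ground M) = rk M' (ground M')"
    using \<pi> by (auto simp: M'.sum_list_rank_seq permutations_of_set_def dest: distinct_card)
qed

text \<open>The factorials in \<open>seq_count_rank_prefix\<close> agree and cancel; if
  \<open>j\<close> exceeds the size of the ground sets, both families are empty.\<close>

lemma card_rank_sets_eq:
  assumes "matroid M" "matroid M'" "\<And>P. seq_count M P = seq_count M' P"
  shows "card {A. A \<subseteq> ground M \<and> card A = j \<and> rk M A = k} =
    card {A. A \<subseteq> ground M' \<and> card A = j \<and> rk M' A = k}"
proof (cases "j \<le> card (ground M)")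
  case True
  then show ?thesis
    using matroid.seq_count_rank_prefix[OF assms(1), of j k]
      matroid.seq_count_rank_prefix[OF assms(2), of j k]
      assms(3) seq_count_eq_imp_card_rk_eq(1)[OF assms] by simp
next
  case False
  then have "{A. A \<subseteq> ground M \<and> card A = j \<and> rk M A = k} = {}"
    using card_mono[OF matroid.finite_ground[OF assms(1)]] by blast
  moreover have "{A. A \<subseteq> ground M' \<and> card A = j \<and> rk M' A = k} = {}"
    using False card_mono[OF matroid.finite_ground[OF assms(2)]]
      seq_count_eq_imp_card_rk_eq(1)[OF assms] by auto
  ultimately show ?thesis
    by (simp only: card.empty)
qed

text \<open>Used to carry a set violating an extremal property of one matroid over to the
  other.\<close>

lemma ex_same_card_rk:
  assumes "matroid M" "matroid M'" "\<And>P. seq_count M P = seq_count M' P" "A' \<subseteq> ground M'"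
  obtains A where "A \<subseteq> ground M" "card A = card A'" "rk M A = rk M' A'"
proof -
  let ?S = "{A. A \<subseteq> ground M' \<and> card A = card A' \<and> rk M' A = rk M' A'}"
  have "finite ?S"
    using matroid.finite_ground[OF assms(2)] by auto
  then have "card ?S \<noteq> 0"
    using assms(4) by auto
  then have "{A. A \<subseteq> ground M \<and> card A = card A' \<and> rk M A = rk M' A'} \<noteq> {}"
    using card_rank_sets_eq[OF assms(1-3), of "card A'" "rk M' A'"] by (metis card.empty)
  then show ?thesis
    using that by blast
qed

text \<open>\<open>seq_count_split\<close> with the same predicate in both matroids gives equal
  products. A trivial predicate on one factor leaves the factorial of the size of its ground set,
  which is nonzero, the same on both sides, and cancels.\<close>

lemma seq_count_minors_eq:
  assumes "matroid M" "matroid M'" "\<And>P. seq_count M P = seq_count M' P"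
    and X: "X \<subseteq> ground M" "X' \<subseteq> ground M'" "card X = card X'" "rk M X = rk M' X'"
    and unique: "\<And>A. A \<subseteq> ground M \<Longrightarrow> card A = card X \<Longrightarrow> rk M A = rk M X \<Longrightarrow> A = X"
    and unique': "\<And>A. A \<subseteq> ground M' \<Longrightarrow> card A = card X' \<Longrightarrow> rk M' A = rk M' X' \<Longrightarrow> A = X'"
  shows "seq_count (restriction M X) P = seq_count (restriction M' X') P"
    and "seq_count (contraction M X) P = seq_count (contraction M' X') P"
proof -
  interpret M: matroid M by fact
  interpret M': matroid M' by fact
  have split: "seq_count (restriction M X) P * seq_count (contraction M X) Q =
      seq_count (restriction M' X') P * seq_count (contraction M' X') Q" for P Q
  proof -
    let ?R = "\<lambda>w. sum_list (take (card X') w) = rk M' X' \<and>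
      P (take (card X') w) \<and> Q (drop (card X') w)"
    have "seq_count (restriction M X) P * seq_count (contraction M X) Q = seq_count M ?R"
      unfolding X(3,4)[symmetric] by (rule M.seq_count_split[OF X(1) unique, symmetric])
    also have "\<dots> = seq_count M' ?R"
      by (rule assms(3))
    also have "\<dots> = seq_count (restriction M' X') P * seq_count (contraction M' X') Q"
      by (rule M'.seq_count_split[OF X(2) unique'])
    finally show ?thesis .
  qed
  have fin: "finite X" "finite X'"
    using X M.finite_ground M'.finite_ground finite_subset by blast+
  have "card (ground M - X) = card (ground M' - X')"
    using X fin seq_count_eq_imp_card_rk_eq(1)[OF assms(1-3)] by (simp add: card_Diff_subset)
  then have "seq_count (contraction M' X') (\<lambda>_. True) = seq_count (contraction M X) (\<lambda>_. True)"
    "seq_count (contraction M X) (\<lambda>_. True) \<noteq> 0"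
    using M.finite_ground M'.finite_ground by (simp_all add: seq_count_True contraction_def)
  then show "seq_count (restriction M X) P = seq_count (restriction M' X') P"
    using split[of P "\<lambda>_. True"] by simp
  have "seq_count (restriction M' X') (\<lambda>_. True) = seq_count (restriction M X) (\<lambda>_. True)"
    "seq_count (restriction M X) (\<lambda>_. True) \<noteq> 0"
    using X fin by (simp_all add: seq_count_True restriction_def)
  then show "seq_count (contraction M X) P = seq_count (contraction M' X') P"
    using split[of "\<lambda>_. True" P] by simp
qed

section \<open>Sharp factorizations\<close>

text \<open>\<open>X\<close> is the ground set of the first factor of a sharp free product factorization. The last
  clause says that every set independent in the free product of \<open>M|X\<close> and \<open>M/X\<close> is independent
  in \<open>M\<close>; the clauses before it say that \<open>M/X\<close> has no loops, that \<open>M|X\<close> has no coloops, and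
  that both factors have at least two cyclic flats.\<close>

definition sharp_factor :: "'a indep_struct \<Rightarrow> 'a set \<Rightarrow> bool" where
  "sharp_factor M X \<longleftrightarrow> X \<in> flats M \<and> (\<forall>x\<in>X. rk M (X - {x}) = rk M X) \<and> 0 < rk M X \<and>
    rk M (ground M) < rk M X + card (ground M - X) \<and>
    (\<forall>I. I \<subseteq> ground M \<and> I \<inter> X \<in> indeps M \<and> card I \<le> rk M (I \<union> X) \<longrightarrow> I \<in> indeps M)"

lemma two_le_card:
  assumes "finite C" "x \<in> C" "C \<noteq> {x}"
  shows "2 \<le> card C"
proof -
  obtain y where "y \<in> C" "y \<noteq> x"
    using assms by blast
  then show ?thesis
    using assms card_mono[of C "{x, y}"] by simp
qed

section \<open>From pinchpoints to sharp factors, and uniqueness of the latter\<close>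

context matroid
begin

lemma rk_remove_circuit_element:
  assumes "C \<in> circuits M" "C \<subseteq> A" "x \<in> C"
  shows "rk M (A - {x}) = rk M A"
proof -
  have "rk M (insert x (C - {x})) = rk M (C - {x})"
    using rk_circuit_remove[OF assms(1,3)] assms(3) by (simp add: insert_absorb)
  then have "rk M (insert x (A - {x})) = rk M (A - {x})"
    by (rule rk_insert_absorb_mono) (use assms in blast)
  moreover have "insert x (A - {x}) = A"
    using assms by blast
  ultimately show ?thesis
    by simp
qed

text \<open>The two strict inequalities hold because \<open>X\<close> is neither least nor greatest.
  For the last clause, take a circuit \<open>C\<close> in a dependent \<open>I\<close> and compare
  \<open>cl C\<close> with \<open>X\<close>: if it contains \<open>X\<close>, then \<open>I\<close>
  already has rank \<open>card I\<close>; if it lies in \<open>X\<close>, then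
  \<open>I \<inter> X\<close> is dependent.\<close>

lemma pinchpoint_imp_sharp_factor:
  assumes "pinchpoint M X"
  shows "sharp_factor M X"
proof -
  have X: "X \<in> cyclic_flats M" and flat: "X \<in> flats M"
    using assms by (auto simp: pinchpoint_def cyclic_flats_def)
  have sub: "X \<subseteq> ground M"
    using flat by (simp add: flats_def)
  obtain \<C> where \<C>: "\<C> \<subseteq> circuits M" "X = \<Union>\<C>"
    using X by (auto simp: cyclic_flats_def)
  have no_coloop: "rk M (X - {x}) = rk M X" if "x \<in> X" for x
    using that \<C> rk_remove_circuit_element[of _ X x] by (metis UnionE Union_upper subsetD)
  have pos: "0 < rk M X"
  proof (rule ccontr)
    assume "\<not> 0 < rk M X"
    then have zero: "rk M X = 0"
      by simp
    \<comment> \<open>A set of rank zero consists of loops, and every flat contains all loops, so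
      \<open>X\<close> would be the minimum.\<close>
    have "X \<subseteq> Y" if Y: "Y \<in> cyclic_flats M" for Y
    proof
      fix x assume x: "x \<in> X"
      have "rk M {x} \<le> rk M X"
        using x by (intro rk_mono) simp
      then have "rk M (insert x {}) = rk M {}"
        using zero by (simp add: rk_empty)
      then have "rk M (insert x Y) = rk M Y"
        by (rule rk_insert_absorb_mono) simp
      then show "x \<in> Y"
        using Y x sub unfolding cyclic_flats_def flats_def
        by (metis (no_types, lifting) DiffI less_irrefl mem_Collect_eq subsetD)
    qed
    then show False
      using assms by (simp add: pinchpoint_def)
  qed
  have nullity: "rk M (ground M) < rk M X + card (ground M - X)"
  proof -
    \<comment> \<open>A cyclic flat not inside \<open>X\<close> yields a circuit element
      \<open>e\<close> outside \<open>X\<close>. Deleting \<open>e\<close> keeps the full rank but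
      lowers the bound given by the remaining elements outside \<open>X\<close> by one.\<close>
    obtain Y where Y: "Y \<in> cyclic_flats M" "\<not> Y \<subseteq> X"
      using assms by (auto simp: pinchpoint_def)
    then obtain C e where C: "C \<in> circuits M" "e \<in> C" "e \<notin> X"
      by (auto simp: cyclic_flats_def)
    have e: "e \<in> ground M"
      using C circuit_subset by blast
    have "rk M (ground M) = rk M (ground M - {e})"
      using rk_remove_circuit_element[OF C(1) circuit_subset[OF C(1)] C(2)] by simp
    also have "ground M - {e} = X \<union> ((ground M - X) - {e})"
      using sub C by blast
    also have "rk M \<dots> \<le> rk M X + card ((ground M - X) - {e})"
      using finite_ground by (intro rk_Un_le) simp
    also have "\<dots> < rk M X + card (ground M - X)"
      using finite_ground C e by (intro add_strict_left_mono psubset_card_mono) auto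
    finally show ?thesis .
  qed
  have "I \<in> indeps M"
    if I: "I \<subseteq> ground M" "I \<inter> X \<in> indeps M" "card I \<le> rk M (I \<union> X)" for I
  proof (rule ccontr)
    assume "I \<notin> indeps M"
    then obtain C where C: "C \<in> circuits M" "C \<subseteq> I"
      using dep_contains_circuit[OF I(1)] by blast
    have "cl C \<in> cyclic_flats M"
      using cyclic_flat_cl_Union[of "{C}"] C by simp
    then consider "X \<subseteq> cl C" | "cl C \<subseteq> X"
      using assms by (auto simp: pinchpoint_def)
    then show False
    proof cases
      case 1
      then have "rk M (I \<union> X) \<le> rk M (I \<union> cl C)"
        by (intro rk_mono) auto
      also have "\<dots> = rk M I"
        by (rule rk_Un_cl[OF C(2)])
      finally have "card I \<le> rk M I"
        using I by simp
      moreover have "finite I"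
        using I finite_ground finite_subset by blast
      ultimately have "I \<in> indeps M"
        using I rk_le_card[of I] by (simp add: indep_iff_rk)
      then show False
        using \<open>I \<notin> indeps M\<close> by simp
    next
      case 2
      then have "C \<subseteq> I \<inter> X"
        using C subset_cl[OF circuit_subset[OF C(1)]] by blast
      then show False
        using I indep_mono circuit_dep C by blast
    qed
  qed
  then show ?thesis
    using flat no_coloop pos nullity by (simp add: sharp_factor_def)
qed

text \<open>Otherwise \<open>A\<close> contains an independent set \<open>I\<close> of size
  \<open>rk M X + 1\<close>: a basis \<open>J\<close> of \<open>A \<inter> X\<close> plus elements
  of \<open>A - X\<close>. Since \<open>J\<close> has at most \<open>rk M X\<close> elements,
  \<open>I\<close> leaves the flat \<open>X\<close>, so \<open>I \<union> X\<close> has rank at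
  least \<open>card I\<close>, and the last clause of \<open>sharp_factor\<close> applies.\<close>

lemma sharp_factor_unique:
  assumes "sharp_factor M X" "A \<subseteq> ground M" "card X \<le> card A" "rk M A = rk M X"
  shows "A = X"
proof (rule ccontr)
  assume "A \<noteq> X"
  have sub: "X \<subseteq> ground M"
    using assms(1) by (simp add: sharp_factor_def flats_def)
  have fin: "finite X" "finite A"
    using sub assms(2) finite_ground finite_subset by blast+
  have diff: "card (X - A) \<le> card (A - X)"
    using assms(3) fin by (simp add: card_Diff_subset_Int Int_commute diff_le_mono)
  have ne: "A - X \<noteq> {}"
    using \<open>A \<noteq> X\<close> assms(3) fin card_seteq by blast
  \<comment> \<open>There is room for \<open>I\<close>. If \<open>X\<close> is not inside
    \<open>A\<close>, some \<open>x\<close> of \<open>X - A\<close> can be deleted from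
    \<open>X\<close> without loss of rank, as \<open>X\<close> has no coloop; the rest of
    \<open>X - A\<close> then has fewer elements than \<open>A - X\<close>.\<close>
  have "Suc (rk M X) \<le> rk M (A \<inter> X) + card (A - X)"
  proof (cases "X \<subseteq> A")
    case True
    then show ?thesis
      using ne fin by (simp add: Int_absorb1 card_gt_0_iff Suc_leI)
  next
    case False
    then obtain x where x: "x \<in> X - A"
      by blast
    have "rk M X = rk M (X - {x})"
      using assms(1) x by (simp add: sharp_factor_def)
    also have "X - {x} = (A \<inter> X) \<union> ((X - A) - {x})"
      using x by blast
    also have "rk M \<dots> \<le> rk M (A \<inter> X) + card ((X - A) - {x})"
      using fin by (intro rk_Un_le) simp
    also have "\<dots> < rk M (A \<inter> X) + card (X - A)"
      using fin x by (intro add_strict_left_mono psubset_card_mono) auto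
    finally show ?thesis
      using diff by simp
  qed
  moreover obtain J where J: "J \<in> indeps M" "J \<subseteq> A \<inter> X" "card J = rk M (A \<inter> X)"
    by (rule rk_witness)
  moreover have "card (J \<union> (A - X)) = card J + card (A - X)"
    using J fin by (intro card_Un_disjoint) (auto intro: finite_subset)
  moreover have JX: "card J \<le> rk M X"
    using J by (intro card_le_rk) auto
  ultimately obtain I where I: "J \<subseteq> I" "I \<subseteq> J \<union> (A - X)" "card I = Suc (rk M X)"
    using exists_subset_between[of J "Suc (rk M X)" "J \<union> (A - X)"] fin finite_indep[OF J(1)]
    by auto
  have "I \<inter> X = J"
    using I J by blast
  moreover obtain y where y: "y \<in> I - X"
  proof -
    have "\<not> I \<subseteq> J"
      using I JX card_mono[OF finite_indep[OF J(1)], of I] by auto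
    then show thesis
      using that I by blast
  qed
  have "card I \<le> rk M (I \<union> X)"
  proof -
    have "y \<in> ground M - X"
      using y I J assms(2) by blast
    then have "rk M X < rk M (insert y X)"
      using assms(1) by (simp add: sharp_factor_def flats_def)
    also have "\<dots> \<le> rk M (I \<union> X)"
      using y by (intro rk_mono) auto
    finally show ?thesis
      using I by simp
  qed
  moreover have IA: "I \<subseteq> A"
    using I J by blast
  ultimately have "I \<in> indeps M"
    using assms(1,2) J by (auto simp: sharp_factor_def)
  then have "card I \<le> rk M A"
    using IA by (rule card_le_rk)
  then show False
    using I assms(4) by simp
qed

text \<open>The factors are the restriction to \<open>X\<close> and the contraction of
  \<open>X\<close>. Bases of \<open>M\<close> are always bases of their free product, and
  \<open>bases\<close> supplies the converse.\<close>

lemma proper_free_product_if_bases: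
  assumes flat: "X \<in> flats M"
    and no_coloop: "\<And>x. x \<in> X \<Longrightarrow> rk M (X - {x}) = rk M X"
    and pos: "0 < rk M X"
    and nullity: "rk M (ground M) < rk M X + card (ground M - X)"
    and bases: "\<And>B. B \<subseteq> ground M \<Longrightarrow> card B = rk M (ground M) \<Longrightarrow> B \<inter> X \<in> indeps M \<Longrightarrow>
      rk M (B \<union> X) = rk M (ground M) \<Longrightarrow> B \<in> indeps M"
  shows "proper_free_product M"
proof -
  let ?E = "ground M" and ?R = "restriction M X" and ?K = "contraction M X"
  have sub: "X \<subseteq> ?E"
    using flat by (simp add: flats_def)
  interpret R: matroid ?R
    by (rule matroid_restriction[OF sub])
  interpret K: matroid ?K
    by (rule matroid_contraction)
  have gR: "ground ?R = X" and gK: "ground ?K = ?E - X"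
    by (simp_all add: restriction_def contraction_def)
  have "2 \<le> card (cyclic_flats ?R)"
  proof -
    \<comment> \<open>A non-loop \<open>x\<close> of \<open>X\<close> is not a coloop of the
      restriction, so it lies on a circuit there, and this circuit is not
      \<open>{x}\<close>.\<close>
    obtain I where I: "I \<in> indeps M" "I \<subseteq> X" "card I = rk M X"
      by (rule rk_witness)
    then obtain x where x: "x \<in> I"
      using pos by fastforce
    obtain B where B: "B \<in> indeps M" "B \<subseteq> X - {x}" "card B = rk M (X - {x})"
      by (rule rk_witness)
    have "insert x B \<notin> indeps M"
    proof
      assume "insert x B \<in> indeps M"
      then have "card (insert x B) \<le> rk M X"
        using B x I by (intro card_le_rk) auto
      moreover have "card (insert x B) = Suc (card B)"
        using B finite_indep by (intro card_insert_disjoint) auto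
      ultimately show False
        using B no_coloop[of x] x I by auto
    qed
    then have "insert x B \<subseteq> ground ?R" "insert x B \<notin> indeps ?R"
      using B x I by (auto simp: restriction_def)
    then obtain C where C: "C \<in> circuits ?R" "C \<subseteq> insert x B"
      by (rule R.dep_contains_circuit)
    have "x \<in> C"
    proof (rule ccontr)
      assume "x \<notin> C"
      then have "C \<subseteq> B"
        using C by blast
      then have "C \<in> indeps ?R"
        using indep_mono[OF B(1)] B by (auto simp: restriction_def)
      then show False
        using R.circuit_dep[OF C(1)] by simp
    qed
    moreover have "{x} \<in> indeps ?R"
      using indep_mono[OF I(1)] x I by (auto simp: restriction_def)
    then have "C \<noteq> {x}"
      using R.circuit_dep[OF C(1)] by auto
    moreover have "finite C"
      using C finite_indep[OF B(1)] finite_subset by blast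
    ultimately have "2 \<le> card C"
      by (intro two_le_card)
    then show ?thesis
      using C R.two_cyclic_flats_iff by blast
  qed
  moreover have "2 \<le> card (cyclic_flats ?K)"
  proof -
    \<comment> \<open>By \<open>nullity\<close> the contraction has a circuit, and because
      \<open>X\<close> is a flat it has no loops.\<close>
    have "ground ?K \<notin> indeps ?K"
    proof
      assume "ground ?K \<in> indeps ?K"
      then have "rk M ((?E - X) \<union> X) = card (?E - X) + rk M X"
        by (simp add: contraction_def)
      moreover have "(?E - X) \<union> X = ?E"
        using sub by blast
      ultimately show False
        using nullity by simp
    qed
    then obtain C where C: "C \<in> circuits ?K"
      by (rule K.dep_contains_circuit[OF order_refl])
    have "C \<noteq> {}"
      using K.circuit_dep[OF C] K.empty_indep by auto
    then obtain x where x: "x \<in> C"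
      by blast
    have xE: "x \<in> ?E - X"
      using x K.circuit_subset[OF C] gK by blast
    then have "rk M X < rk M (insert x X)"
      using flat by (simp add: flats_def)
    then have "rk M (insert x X) = Suc (rk M X)"
      using rk_insert_le[of x X] by simp
    then have "{x} \<in> indeps ?K"
      using xE by (simp add: contraction_def)
    then have "C \<noteq> {x}"
      using K.circuit_dep[OF C] by auto
    moreover have "finite C"
      using K.circuit_subset[OF C] K.finite_ground finite_subset by blast
    ultimately have "2 \<le> card C"
      using x by (intro two_le_card)
    then show ?thesis
      using C K.two_cyclic_flats_iff by blast
  qed
  moreover have "M = free_product ?R ?K"
  proof -
    have un: "X \<union> (?E - X) = ?E" "?E - X \<union> X = ?E" "X \<union> ?E = ?E"
      using sub by blast+
    have rR: "rk ?R X = rk M X"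
      by (rule rk_restriction) simp
    have rK: "rk ?K (?E - X) = rk M ?E - rk M X"
      using rk_contraction[OF sub, of "?E - X"] un by simp
    have le: "rk M X \<le> rk M ?E"
      by (rule rk_mono[OF sub])
    have B_iff: "B \<in> free_product_bases ?R ?K \<longleftrightarrow> B \<in> indeps M \<and> card B = rk M ?E" for B
    proof (cases "B \<subseteq> ?E")
      case True
      have "B \<inter> (?E - X) = B - X" "(B - X) \<union> X = B \<union> X"
        using True by blast+
      then have rB: "rk ?K (B \<inter> (?E - X)) = rk M (B \<union> X) - rk M X"
        using rk_contraction[OF sub, of "B - X"] True by auto
      have "rk M X \<le> rk M (B \<union> X)"
        by (intro rk_mono) simp
      then have "rk M (B \<union> X) - rk M X = rk M ?E - rk M X \<longleftrightarrow> rk M (B \<union> X) = rk M ?E"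
        using le by auto
      then have "B \<in> free_product_bases ?R ?K \<longleftrightarrow>
          card B = rk M ?E \<and> B \<inter> X \<in> indeps M \<and> rk M (B \<union> X) = rk M ?E"
        using True le
        by (simp add: free_product_bases_def gR gK un rR rK rB) (simp add: restriction_def)
      also have "\<dots> \<longleftrightarrow> B \<in> indeps M \<and> card B = rk M ?E"
      proof
        assume "card B = rk M ?E \<and> B \<inter> X \<in> indeps M \<and> rk M (B \<union> X) = rk M ?E"
        then show "B \<in> indeps M \<and> card B = rk M ?E"
          using bases True by blast
      next
        assume B: "B \<in> indeps M \<and> card B = rk M ?E"
        then have "rk M ?E \<le> rk M (B \<union> X)"
          using card_le_rk[of B "B \<union> X"] by simp
        moreover have "rk M (B \<union> X) \<le> rk M ?E"
          using True sub by (intro rk_mono) simp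
        ultimately show "card B = rk M ?E \<and> B \<inter> X \<in> indeps M \<and> rk M (B \<union> X) = rk M ?E"
          using B indep_mono[of B "B \<inter> X"] by simp
      qed
      finally show ?thesis .
    next
      case False
      then show ?thesis
        using indeps_subset[of B] by (simp add: free_product_bases_def gR gK un) blast
    qed
    have "indeps M = {I. \<exists>B\<in>free_product_bases ?R ?K. I \<subseteq> B}"
    proof (intro equalityI subsetI CollectI)
      fix I assume I: "I \<in> indeps M"
      obtain B where "B \<in> indeps M" "I \<subseteq> B" "card B = rk M ?E"
        by (rule indep_extend[OF I indeps_subset[OF I]])
      then show "\<exists>B\<in>free_product_bases ?R ?K. I \<subseteq> B"
        using B_iff by blast
    next
      fix I assume "I \<in> {I. \<exists>B\<in>free_product_bases ?R ?K. I \<subseteq> B}"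
      then show "I \<in> indeps M"
        using B_iff indep_mono by blast
    qed
    then show ?thesis
      by (simp add: free_product_def gR gK un)
  qed
  ultimately show ?thesis
    using R.matroid_axioms K.matroid_axioms unfolding proper_free_product_def
    by (metis gR gK Diff_disjoint)
qed

end

text \<open>Completing \<open>I\<close> to a basis takes at least
  \<open>?r2 - rk M2 (I \<inter> ?E2)\<close> new elements in the second ground set. Conversely, if
  the size bound leaves that much room, first make the second part spanning and then fill up from a
  basis of \<open>M1\<close>.\<close>

lemma free_product_indep_iff:
  assumes "matroid M1" "matroid M2" and disj: "ground M1 \<inter> ground M2 = {}"
  shows "I \<in> indeps (free_product M1 M2) \<longleftrightarrow> I \<subseteq> ground M1 \<union> ground M2 \<and>
    I \<inter> ground M1 \<in> indeps M1 \<and> card I \<le> rk M1 (ground M1) + rk M2 (I \<inter> ground M2)"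
proof -
  interpret M1: matroid M1 by fact
  interpret M2: matroid M2 by fact
  let ?E1 = "ground M1" and ?E2 = "ground M2"
  let ?r1 = "rk M1 ?E1" and ?r2 = "rk M2 ?E2"
  have card_split: "card A = card (A \<inter> ?E1) + card (A \<inter> ?E2)" and fin: "finite A"
    if "A \<subseteq> ?E1 \<union> ?E2" for A
  proof -
    show "finite A"
      using that M1.finite_ground M2.finite_ground by (meson finite_UnI finite_subset)
    then have "card ((A \<inter> ?E1) \<union> (A \<inter> ?E2)) = card (A \<inter> ?E1) + card (A \<inter> ?E2)"
      using disj by (intro card_Un_disjoint) auto
    moreover have "(A \<inter> ?E1) \<union> (A \<inter> ?E2) = A"
      using that by blast
    ultimately show "card A = card (A \<inter> ?E1) + card (A \<inter> ?E2)"
      by simp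
  qed
  show ?thesis
  proof
    assume "I \<in> indeps (free_product M1 M2)"
    then obtain B where B: "B \<subseteq> ?E1 \<union> ?E2" "card B = ?r1 + ?r2" "B \<inter> ?E1 \<in> indeps M1"
        "rk M2 (B \<inter> ?E2) = ?r2" and IB: "I \<subseteq> B"
      by (auto simp: free_product_def free_product_bases_def)
    have I: "I \<subseteq> ?E1 \<union> ?E2"
      using B IB by blast
    \<comment> \<open>\<open>B - I\<close> has to raise the rank in \<open>M2\<close> to
      \<open>?r2\<close>, which bounds its size from below and so \<open>card I\<close> from
      above.\<close>
    have "B \<inter> ?E2 = (I \<inter> ?E2) \<union> ((B - I) \<inter> ?E2)"
      using IB by blast
    then have "?r2 \<le> rk M2 (I \<inter> ?E2) + card ((B - I) \<inter> ?E2)"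
      using M2.rk_Un_le[of "(B - I) \<inter> ?E2" "I \<inter> ?E2"] B M2.finite_ground by simp
    moreover have "card ((B - I) \<inter> ?E2) \<le> card (B - I)"
      using fin[OF B(1)] by (intro card_mono) auto
    moreover have "card (B - I) + card I = card B"
      using IB fin[OF B(1)] fin[OF I] card_mono[of B I] by (simp add: card_Diff_subset)
    ultimately have "card I \<le> ?r1 + rk M2 (I \<inter> ?E2)"
      using B by linarith
    moreover have "I \<inter> ?E1 \<in> indeps M1"
      by (rule M1.indep_mono[OF B(3)]) (use IB in blast)
    ultimately show "I \<subseteq> ?E1 \<union> ?E2 \<and> I \<inter> ?E1 \<in> indeps M1 \<and>
        card I \<le> ?r1 + rk M2 (I \<inter> ?E2)"
      using I by blast
  next
    assume I: "I \<subseteq> ?E1 \<union> ?E2 \<and> I \<inter> ?E1 \<in> indeps M1 \<and> card I \<le> ?r1 + rk M2 (I \<inter> ?E2)"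
    then have I1: "I \<inter> ?E1 \<in> indeps M1"
      by blast
    obtain K0 where K0: "K0 \<in> indeps M2" "K0 \<subseteq> I \<inter> ?E2" "card K0 = rk M2 (I \<inter> ?E2)"
      by (rule M2.rk_witness)
    obtain K where K: "K \<in> indeps M2" "K0 \<subseteq> K" "K \<subseteq> ?E2" "card K = ?r2"
      by (rule M2.indep_extend[OF K0(1) M2.indeps_subset[OF K0(1)]])
    obtain B1 where B1: "B1 \<in> indeps M1" "I \<inter> ?E1 \<subseteq> B1" "B1 \<subseteq> ?E1" "card B1 = ?r1"
      by (rule M1.indep_extend[OF I1 M1.indeps_subset[OF I1]])
    define J where "J = (I \<inter> ?E2) \<union> K"
    have J: "J \<subseteq> ?E2" "finite J"
      using K M2.finite_ground by (auto simp: J_def dest: M2.finite_indep)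
    have "?r2 \<le> rk M2 J"
      using K M2.card_le_rk[of K J] by (simp add: J_def)
    moreover have "rk M2 J \<le> ?r2"
      by (rule M2.rk_mono[OF J(1)])
    ultimately have rJ: "rk M2 J = ?r2"
      by simp
    \<comment> \<open>\<open>K0\<close> already lies in \<open>I\<close>, so adding \<open>K\<close>
      costs only \<open>?r2 - rk M2 (I \<inter> ?E2)\<close> elements.\<close>
    have lower: "card (I \<union> K) \<le> ?r1 + ?r2"
    proof -
      have finK: "finite K" "finite K0"
        using K(1) K0(1) by (simp_all add: M2.finite_indep)
      have "I \<union> K = I \<union> (K - K0)"
        using K0 by blast
      then have "card (I \<union> K) \<le> card I + card (K - K0)"
        by (simp add: card_Un_le)
      also have "card (K - K0) = ?r2 - rk M2 (I \<inter> ?E2)"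
        using K K0 finK by (simp add: card_Diff_subset)
      finally show ?thesis
        using I card_mono[OF finK(1) K(2)] K K0 by linarith
    qed
    have "card (B1 \<union> J) = card B1 + card J"
      using B1 J disj M1.finite_indep by (intro card_Un_disjoint) auto
    then have upper: "?r1 + ?r2 \<le> card (B1 \<union> J)"
      using B1 M2.rk_le_card[OF J(2)] rJ by simp
    have "I \<union> K \<subseteq> B1 \<union> J" "finite (B1 \<union> J)"
      using I B1 J M1.finite_indep by (auto simp: J_def)
    then obtain B where B: "I \<union> K \<subseteq> B" "B \<subseteq> B1 \<union> J" "card B = ?r1 + ?r2"
      using exists_subset_between[OF lower upper] by blast
    \<comment> \<open>\<open>J\<close> lies in \<open>I \<union> K\<close>, hence in
      \<open>B\<close>, and \<open>B1\<close> contributes nothing to the second ground set.\<close>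
    have "B \<inter> ?E2 = J"
      using B B1 J disj by (auto simp: J_def)
    moreover have "B \<inter> ?E1 \<in> indeps M1"
      by (rule M1.indep_mono[OF B1(1)]) (use B J disj in blast)
    moreover have "B \<subseteq> ?E1 \<union> ?E2"
      using B B1 J by blast
    ultimately have "B \<in> free_product_bases M1 M2"
      using B rJ by (simp add: free_product_bases_def)
    then show "I \<in> indeps (free_product M1 M2)"
      using B by (auto simp: free_product_def)
  qed
qed

text \<open>The given factorization need not be sharp. If \<open>M1\<close> has no coloops, moving the loops of \<open>M2\<close>
  to the first factor makes it so; otherwise the coloops of \<open>M1\<close> are moved to the second factor.\<close>

lemma sharp_factor_if_proper_free_product:
  assumes "matroid M" "proper_free_product M"
  obtains X where "sharp_factor M X"
proof -
  interpret matroid M by fact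
  obtain M1 M2 where fp: "matroid M1" "matroid M2" "ground M1 \<inter> ground M2 = {}"
      "2 \<le> card (cyclic_flats M1)" "2 \<le> card (cyclic_flats M2)" "M = free_product M1 M2"
    using assms(2) by (auto simp: proper_free_product_def)
  interpret M1: matroid M1 by fact
  interpret M2: matroid M2 by fact
  let ?E1 = "ground M1" and ?E2 = "ground M2"
  let ?r1 = "rk M1 ?E1" and ?r2 = "rk M2 ?E2"
  note disj = fp(3)
  have ground: "ground M = ?E1 \<union> ?E2"
    using fp(6) by (simp add: free_product_def)
  have indep_iff: "I \<in> indeps M \<longleftrightarrow> I \<subseteq> ?E1 \<union> ?E2 \<and> I \<inter> ?E1 \<in> indeps M1 \<and>
      card I \<le> ?r1 + rk M2 (I \<inter> ?E2)" for I
    using free_product_indep_iff[OF fp(1-3)] fp(6) by simp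
  have indep1: "J \<in> indeps M \<longleftrightarrow> J \<in> indeps M1" if "J \<subseteq> ?E1" for J
    using that M1.card_le_rk[of J ?E1] by (auto simp: indep_iff Int_absorb2)
  have rk1: "rk M A = rk M1 A" if "A \<subseteq> ?E1" for A
    unfolding rk_def
    by (rule arg_cong[of _ _ "\<lambda>S. Max (card ` S)"]) (use that indep1 in blast)
  have rk_le: "rk M A \<le> ?r1 + rk M2 (A \<inter> ?E2)" for A
  proof -
    obtain I where I: "I \<in> indeps M" "I \<subseteq> A" "card I = rk M A"
      by (rule rk_witness)
    have "rk M2 (I \<inter> ?E2) \<le> rk M2 (A \<inter> ?E2)"
      using I by (intro M2.rk_mono) blast
    then show ?thesis
      using I indep_iff[of I] by simp
  qed
  obtain C1 where C1: "C1 \<in> circuits M1" "2 \<le> card C1"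
    using fp(4) M1.two_cyclic_flats_iff by blast
  obtain c where c: "c \<in> C1"
    using C1 by fastforce
  obtain C2 where C2: "C2 \<in> circuits M2" "2 \<le> card C2"
    using fp(5) M2.two_cyclic_flats_iff by blast
  \<comment> \<open>The coloops of \<open>M1\<close>.\<close>
  define K where "K = {x \<in> ?E1. rk M1 (?E1 - {x}) \<noteq> ?r1}"
  show thesis
  proof (cases "K = {}")
    case True
    define L where "L = M2.cl {}"
    define X where "X = ?E1 \<union> L"
    have L: "L \<subseteq> ?E2"
      using M2.cl_subset_ground by (simp add: L_def)
    have rk_L: "rk M2 (A \<union> L) = rk M2 A" for A
      unfolding L_def by (rule M2.rk_Un_cl) simp
    have "X \<inter> ?E2 = {} \<union> L"
      using L disj by (auto simp: X_def)
    then have "rk M X \<le> ?r1"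
      using rk_le[of X] rk_L[of "{}"] M2.rk_empty by simp
    moreover have "?r1 \<le> rk M X"
      using rk_mono[of ?E1 X] rk1[of ?E1] by (simp add: X_def)
    ultimately have rX: "rk M X = ?r1"
      by simp
    have "rk M X < rk M (insert x X)" if x: "x \<in> ground M - X" for x
    proof -
      have x2: "x \<in> ?E2" "x \<notin> ?E1" "x \<notin> M2.cl {}"
        using x ground by (auto simp: X_def L_def)
      then have "rk M2 {x} \<noteq> 0"
        by (simp add: M2.cl_def M2.rk_empty)
      moreover obtain B where B: "B \<in> indeps M1" "B \<subseteq> ?E1" "card B = ?r1"
        by (rule M1.rk_witness)
      moreover have "insert x B \<inter> ?E1 = B" "insert x B \<inter> ?E2 = {x}"
        using B x2 disj by auto
      moreover have cB: "card (insert x B) = Suc ?r1"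
        using B x2 M1.finite_indep by (subst card_insert_disjoint) auto
      moreover have "insert x B \<subseteq> ?E1 \<union> ?E2"
        using B x2 by blast
      ultimately have "insert x B \<in> indeps M"
        unfolding indep_iff by simp
      then have "card (insert x B) \<le> rk M (insert x X)"
        using B by (intro card_le_rk) (auto simp: X_def)
      then show ?thesis
        using cB rX by simp
    qed
    then have "X \<in> flats M"
      using ground L by (auto simp: flats_def X_def)
    moreover have "rk M (X - {x}) = rk M X" if "x \<in> X" for x
    proof -
      have "rk M1 (?E1 - {x}) = ?r1"
        using True by (cases "x \<in> ?E1") (auto simp: K_def)
      then have "?r1 \<le> rk M (X - {x})"
        using rk_mono[of "?E1 - {x}" "X - {x}"] rk1[of "?E1 - {x}"] by (auto simp: X_def)
      then show ?thesis
        using rX rk_mono[of "X - {x}" X] by auto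
    qed
    moreover have "0 < rk M X"
    proof -
      have "rk M1 {c} \<le> ?r1"
        using c M1.circuit_subset[OF C1(1)] by (intro M1.rk_mono) blast
      then show ?thesis
        using M1.rk_singleton_circuit[OF C1 c] rX by simp
    qed
    moreover have "rk M (ground M) < rk M X + card (ground M - X)"
    proof -
      \<comment> \<open>A circuit with two or more elements avoids loops, so \<open>M2\<close> stays
        dependent after its loops are removed.\<close>
      have C2L: "C2 \<subseteq> ?E2 - L"
      proof
        fix x assume x: "x \<in> C2"
        then have "rk M2 {x} = 1"
          by (rule M2.rk_singleton_circuit[OF C2])
        then show "x \<in> ?E2 - L"
          using x M2.circuit_subset[OF C2(1)] by (auto simp: L_def M2.cl_def M2.rk_empty)
      qed
      then have "?E2 - L \<notin> indeps M2"
        using M2.indep_mono M2.circuit_dep[OF C2(1)] by blast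
      then have "rk M2 (?E2 - L) \<noteq> card (?E2 - L)"
        using M2.indep_iff_rk[of "?E2 - L"] by blast
      then have "rk M2 (?E2 - L) < card (?E2 - L)"
        using M2.rk_le_card[of "?E2 - L"] M2.finite_ground by simp
      moreover have "(?E2 - L) \<union> L = ?E2"
        using L by blast
      then have "?r2 = rk M2 (?E2 - L)"
        using rk_L[of "?E2 - L"] by simp
      moreover have "ground M \<inter> ?E2 = ?E2" "ground M - X = ?E2 - L"
        using disj ground L by (auto simp: X_def)
      ultimately show ?thesis
        using rk_le[of "ground M"] rX by simp
    qed
    moreover have "I \<in> indeps M"
      if I: "I \<subseteq> ground M" "I \<inter> X \<in> indeps M" "card I \<le> rk M (I \<union> X)" for I
    proof -
      have "I \<inter> ?E1 \<in> indeps M"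
        by (rule indep_mono[OF I(2)]) (auto simp: X_def)
      then have "I \<inter> ?E1 \<in> indeps M1"
        using indep1 by simp
      moreover have "(I \<union> X) \<inter> ?E2 = (I \<inter> ?E2) \<union> L"
        using disj L by (auto simp: X_def)
      then have "card I \<le> ?r1 + rk M2 (I \<inter> ?E2)"
        using I(3) rk_le[of "I \<union> X"] rk_L[of "I \<inter> ?E2"] by simp
      ultimately show ?thesis
        using I(1) ground by (simp add: indep_iff)
    qed
    ultimately have "sharp_factor M X"
      by (simp add: sharp_factor_def)
    then show thesis
      by (rule that)
  next
    case False
    define X where "X = ?E1 - K"
    have K: "K \<subseteq> ?E1" "finite K"
      using M1.finite_ground by (auto simp: K_def)
    \<comment> \<open>Coloops lie in every basis, in particular in one that contains
      \<open>J\<close>.\<close>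
    have add_K: "J \<union> K \<in> indeps M1" if J: "J \<in> indeps M1" for J
    proof -
      obtain B where B: "B \<in> indeps M1" "J \<subseteq> B" "B \<subseteq> ?E1" "card B = ?r1"
        by (rule M1.indep_extend[OF J M1.indeps_subset[OF J]])
      have "K \<subseteq> B"
      proof
        fix x assume x: "x \<in> K"
        show "x \<in> B"
        proof (rule ccontr)
          assume "x \<notin> B"
          then have "?r1 \<le> rk M1 (?E1 - {x})"
            using B M1.card_le_rk[of B "?E1 - {x}"] by auto
          then show False
            using x M1.rk_mono[of "?E1 - {x}" ?E1] by (auto simp: K_def)
        qed
      qed
      then show ?thesis
        using M1.indep_mono[OF B(1)] B by simp
    qed
    have XE: "X \<subseteq> ?E1"
      by (auto simp: X_def)
    obtain J where J: "J \<in> indeps M1" "J \<subseteq> X" "card J = rk M1 X"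
      by (rule M1.rk_witness)
    have finJ: "finite J"
      using J M1.finite_indep by simp
    have "card (J \<union> K) = card J + card K"
      using J K finJ by (intro card_Un_disjoint) (auto simp: X_def)
    moreover have "card (J \<union> K) \<le> ?r1"
      using add_K[OF J(1)] M1.indeps_subset by (intro M1.card_le_rk) auto
    ultimately have rX1: "rk M1 X + card K \<le> ?r1"
      using J by simp
    have cK: "0 < card K"
      using False K by (simp add: card_gt_0_iff)
    have rX: "rk M X = rk M1 X"
      by (rule rk1[OF XE])
    have "rk M X < rk M (insert x X)" if x: "x \<in> ground M - X" for x
    proof -
      have xJ: "x \<notin> J"
        using x J by blast
      have "insert x J \<in> indeps M"
      proof (cases "x \<in> ?E1")
        case True
        then have "x \<in> K"
          using x by (simp add: X_def)
        then have "insert x J \<in> indeps M1"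
          using M1.indep_mono[OF add_K[OF J(1)]] by simp
        then show ?thesis
          using True J XE indep1 by auto
      next
        \<comment> \<open>Since there is a coloop, \<open>J\<close> has fewer than
          \<open>?r1\<close> elements. The size bound therefore has room for \<open>x\<close>, even
          if \<open>x\<close> is a loop of \<open>M2\<close>.\<close>
        case False
        then have "insert x J \<inter> ?E1 = J"
          using J XE by blast
        then show ?thesis
          using J XE x ground rX1 cK xJ finJ by (auto simp: indep_iff)
      qed
      then have "card (insert x J) \<le> rk M (insert x X)"
        using J by (intro card_le_rk) auto
      then show ?thesis
        using J rX xJ finJ by simp
    qed
    then have "X \<in> flats M"
      using ground XE by (auto simp: flats_def)
    moreover have "rk M (X - {x}) = rk M X" if x: "x \<in> X" for x
    proof -
      \<comment> \<open>Deleting the non-coloop \<open>x\<close> leaves rank \<open>?r1\<close>, of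
        which \<open>K\<close> accounts for at most \<open>card K\<close>; what remains is at least
        \<open>rk M1 X\<close>.\<close>
      have "?r1 = rk M1 (?E1 - {x})"
        using x by (auto simp: X_def K_def)
      also have "\<dots> \<le> rk M1 ((X - {x}) \<union> K)"
        by (intro M1.rk_mono) (auto simp: X_def)
      also have "\<dots> \<le> rk M1 (X - {x}) + card K"
        by (rule M1.rk_Un_le[OF K(2)])
      finally have "rk M1 X \<le> rk M1 (X - {x})"
        using rX1 by simp
      then show ?thesis
        using M1.rk_mono[of "X - {x}" X] rk1[of "X - {x}"] rX XE by auto
    qed
    moreover have "0 < rk M X"
    proof -
      have "c \<in> X"
        using M1.rk_remove_circuit_element[OF C1(1) M1.circuit_subset[OF C1(1)] c] c
          M1.circuit_subset[OF C1(1)] by (auto simp: X_def K_def)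
      then have "rk M1 {c} \<le> rk M1 X"
        by (intro M1.rk_mono) simp
      then show ?thesis
        using M1.rk_singleton_circuit[OF C1 c] rX by simp
    qed
    moreover have "rk M (ground M) < rk M X + card (ground M - X)"
    proof -
      have "?E2 \<notin> indeps M2"
        using M2.indep_mono[of ?E2 C2] M2.circuit_dep[OF C2(1)] M2.circuit_subset[OF C2(1)] by blast
      then have "?r2 \<noteq> card ?E2"
        using M2.indep_iff_rk[of ?E2] by blast
      then have "?r2 < card ?E2"
        using M2.rk_le_card[of ?E2] M2.finite_ground by simp
      moreover have "?r1 \<le> rk M1 X + card K"
        using M1.rk_Un_le[OF K(2), of X] K by (simp add: X_def Un_absorb2)
      moreover have "card (K \<union> ?E2) = card K + card ?E2"
        using K disj M2.finite_ground by (intro card_Un_disjoint) auto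
      moreover have "ground M - X = K \<union> ?E2" "ground M \<inter> ?E2 = ?E2"
        using ground K disj by (auto simp: X_def)
      ultimately show ?thesis
        using rk_le[of "ground M"] rX by simp
    qed
    moreover have "I \<in> indeps M"
      if I: "I \<subseteq> ground M" "I \<inter> X \<in> indeps M" "card I \<le> rk M (I \<union> X)" for I
    proof -
      have "I \<inter> X \<in> indeps M1"
        using I(2) indep1[of "I \<inter> X"] XE by blast
      then have "(I \<inter> X) \<union> K \<in> indeps M1"
        by (rule add_K)
      then have "I \<inter> ?E1 \<in> indeps M1"
        by (rule M1.indep_mono) (auto simp: X_def)
      moreover have "(I \<union> X) \<inter> ?E2 = I \<inter> ?E2"
        using disj XE by blast
      then have "card I \<le> ?r1 + rk M2 (I \<inter> ?E2)"
        using I(3) rk_le[of "I \<union> X"] by simp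
      ultimately show ?thesis
        using I(1) ground by (simp add: indep_iff)
    qed
    ultimately have "sharp_factor M X"
      by (simp add: sharp_factor_def)
    then show thesis
      by (rule that)
  qed
qed

section \<open>Counting bases of the free product, and transfer of a factorization\<close>

context matroid
begin

text \<open>A basis of the free product splits into an independent \<open>i\<close>-subset of
  \<open>X\<close> and a spanning set of the contraction with the remaining elements. Both are
  phrased by size and rank in the minors, so that \<open>card_rank_sets_eq\<close> applies to each
  factor.\<close>

lemma card_free_product_bases:
  assumes "X \<subseteq> ground M"
  shows "card {B. B \<subseteq> ground M \<and> card B = rk M (ground M) \<and> B \<inter> X \<in> indeps M \<and>
      rk M (B \<union> X) = rk M (ground M)} =
    (\<Sum>i\<le>rk M (ground M).
      card {A. A \<subseteq> ground (restriction M X) \<and> card A = i \<and> rk (restriction M X) A = i} *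
      card {A. A \<subseteq> ground (contraction M X) \<and> card A = rk M (ground M) - i \<and>
        rk (contraction M X) A = rk M (ground M) - rk M X})"
    (is "card ?F = (\<Sum>i\<le>?r. card (?I i) * card (?S i))")
proof -
  let ?E = "ground M"
  have fX: "finite X"
    using assms finite_ground finite_subset by blast
  have I: "?I i = {A. A \<subseteq> X \<and> card A = i \<and> A \<in> indeps M}" for i
  proof -
    have "rk (restriction M X) A = i \<longleftrightarrow> A \<in> indeps M" if "A \<subseteq> X" "card A = i" for A
      using that assms rk_restriction[OF that(1)] by (auto simp: indep_iff_rk)
    moreover have "ground (restriction M X) = X"
      by (simp add: restriction_def)
    ultimately show ?thesis
      by auto
  qed
  have le: "rk M X \<le> ?r" "rk M X \<le> rk M (A \<union> X)" for A
    using assms by (auto intro: rk_mono)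
  have S: "?S i = {A. A \<subseteq> ?E - X \<and> card A = ?r - i \<and> rk M (A \<union> X) = ?r}" for i
  proof -
    have "rk (contraction M X) A = ?r - rk M X \<longleftrightarrow> rk M (A \<union> X) = ?r" if "A \<subseteq> ?E - X" for A
      using rk_contraction[OF assms that] le(1) le(2)[of A] by auto
    moreover have "ground (contraction M X) = ?E - X"
      by (simp add: contraction_def)
    ultimately show ?thesis
      by auto
  qed
  have "bij_betw (\<lambda>(i, A, A'). A \<union> A') (SIGMA i:{..?r}. ?I i \<times> ?S i) ?F"
  proof (rule bij_betwI[where g = "\<lambda>B. (card (B \<inter> X), B \<inter> X, B - X)"])
    show "(\<lambda>(i, A, A'). A \<union> A') \<in> (SIGMA i:{..?r}. ?I i \<times> ?S i) \<rightarrow> ?F"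
    proof (intro funcsetI)
      fix p assume "p \<in> (SIGMA i:{..?r}. ?I i \<times> ?S i)"
      then obtain i A A' where i: "p = (i, A, A')" "i \<in> {..?r}" "A \<in> ?I i" "A' \<in> ?S i"
        by (elim SigmaE) blast
      then have A: "A \<subseteq> X" "card A = i" "A \<in> indeps M"
        and A': "A' \<subseteq> ?E - X" "card A' = ?r - i" "rk M (A' \<union> X) = ?r"
        using I S by auto
      have "card (A \<union> A') = card A + card A'"
        using A A' fX finite_ground by (intro card_Un_disjoint) (auto intro: finite_subset)
      then have "card (A \<union> A') = ?r"
        using A A' i by simp
      moreover have "(A \<union> A') \<inter> X = A" "(A \<union> A') \<union> X = A' \<union> X" "A \<union> A' \<subseteq> ?E"
        using A A' assms by auto
      ultimately show "(case p of (i, A, A') \<Rightarrow> A \<union> A') \<in> ?F"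
        using A A' i(1) by simp
    qed
    show "(\<lambda>B. (card (B \<inter> X), B \<inter> X, B - X)) \<in> ?F \<rightarrow> (SIGMA i:{..?r}. ?I i \<times> ?S i)"
    proof (intro funcsetI)
      fix B assume "B \<in> ?F"
      then have B: "B \<subseteq> ?E" "card B = ?r" "B \<inter> X \<in> indeps M" "rk M (B \<union> X) = ?r"
        by auto
      have fB: "finite B"
        using B finite_ground finite_subset by blast
      then have "card (B \<inter> X) \<le> ?r"
        using B card_mono[of B "B \<inter> X"] by simp
      moreover have "card (B - X) = ?r - card (B \<inter> X)"
        using fB B by (simp add: card_Diff_subset_Int)
      moreover have "B - X \<union> X = B \<union> X"
        by blast
      ultimately show "(card (B \<inter> X), B \<inter> X, B - X) \<in> (SIGMA i:{..?r}. ?I i \<times> ?S i)"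
        using B by (auto simp: I S)
    qed
  qed (auto simp: I S Int_absorb2 intro!: arg_cong[of _ _ card])
  then have "card ?F = card (SIGMA i:{..?r}. ?I i \<times> ?S i)"
    by (simp add: bij_betw_same_card)
  also have "\<dots> = (\<Sum>i\<le>?r. card (?I i \<times> ?S i))"
    using fX finite_ground by (intro card_SigmaI) (auto simp: I S)
  finally show ?thesis
    by (simp add: card_cartesian_product)
qed

end

lemma proper_free_product_transfer:
  assumes "matroid M" "matroid M'" "\<And>P. seq_count M P = seq_count M' P" "proper_free_product M"
  shows "proper_free_product M'"
proof -
  interpret M: matroid M by fact
  interpret M': matroid M' by fact
  let ?E = "ground M" and ?E' = "ground M'"
  let ?r = "rk M ?E"
  obtain X where sharp: "sharp_factor M X"
    by (rule sharp_factor_if_proper_free_product[OF assms(1,4)])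
  have X: "X \<subseteq> ?E"
    using sharp by (simp add: sharp_factor_def flats_def)
  have unique: "A = X" if "A \<subseteq> ?E" "card X \<le> card A" "rk M A = rk M X" for A
    using M.sharp_factor_unique[OF sharp that] .
  note eq = seq_count_eq_imp_card_rk_eq[OF assms(1-3)]
  \<comment> \<open>Uniqueness is a count equal to one, which passes to \<open>M'\<close> and
    produces \<open>X'\<close>.\<close>
  have "{A. A \<subseteq> ?E \<and> card A = card X \<and> rk M A = rk M X} = {X}"
    using unique X by (intro equalityI subsetI) simp_all
  then have "card {A. A \<subseteq> ?E' \<and> card A = card X \<and> rk M' A = rk M X} = 1"
    using card_rank_sets_eq[OF assms(1-3), of "card X" "rk M X"] by simp
  then obtain X' where X'_eq: "{A. A \<subseteq> ?E' \<and> card A = card X \<and> rk M' A = rk M X} = {X'}"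
    by (rule card_1_singletonE)
  then have X': "X' \<subseteq> ?E'" "card X = card X'" "rk M X = rk M' X'"
    by auto
  have unique': "A = X'" if "A \<subseteq> ?E'" "card A = card X'" "rk M' A = rk M' X'" for A
    using that X'_eq X' by auto
  have fin: "finite X" "finite X'"
    using X X' M.finite_ground M'.finite_ground finite_subset by blast+
  let ?R = "restriction M X" and ?R' = "restriction M' X'"
  let ?K = "contraction M X" and ?K' = "contraction M' X'"
  have R: "matroid ?R" "matroid ?R'" and K: "matroid ?K" "matroid ?K'"
    by (simp_all add: M.matroid_restriction X M'.matroid_restriction X'
        M.matroid_contraction M'.matroid_contraction)
  have seq_R: "seq_count ?R P = seq_count ?R' P" and seq_K: "seq_count ?K P = seq_count ?K' P" for P
    by (rule seq_count_minors_eq[OF assms(1-3) X X' unique unique']; simp)+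
  have flat: "X' \<in> flats M'"
  proof -
    \<comment> \<open>If \<open>x\<close> did not raise the rank, \<open>M\<close> would have a set
      of rank \<open>rk M X\<close> with \<open>card X + 1\<close> elements, against the maximality
      of \<open>X\<close>.\<close>
    have "rk M' X' < rk M' (insert x X')" if x: "x \<in> ?E' - X'" for x
    proof (rule ccontr)
      assume "\<not> rk M' X' < rk M' (insert x X')"
      then have *: "rk M' (insert x X') = rk M X"
        using M'.rk_mono[OF subset_insertI, of X' x] X' by simp
      obtain A where A: "A \<subseteq> ?E" "card A = card (insert x X')" "rk M A = rk M' (insert x X')"
        by (rule ex_same_card_rk[OF assms(1-3), of "insert x X'"]) (use x X' in auto)
      then have "card A = Suc (card X)"
        using x X' fin by simp
      moreover have "A = X"
        using unique[OF A(1)] A * \<open>card A = Suc (card X)\<close> by simp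
      ultimately show False
        by simp
    qed
    then show ?thesis
      using X' by (simp add: flats_def)
  qed
  have no_coloop: "rk M' (X' - {x}) = rk M' X'" if x: "x \<in> X'" for x
  proof -
    \<comment> \<open>Some subset of \<open>X\<close> has the same size and rank as
      \<open>X' - {x}\<close>. It is \<open>X\<close> without one element, and this has rank
      \<open>rk M X\<close> because the restriction of \<open>M\<close> to \<open>X\<close> has no
      coloops.\<close>
    have "X' - {x} \<subseteq> ground ?R'"
      by (auto simp: restriction_def)
    then obtain A where A: "A \<subseteq> ground ?R" "card A = card (X' - {x})" "rk ?R A = rk ?R' (X' - {x})"
      by (rule ex_same_card_rk[OF R seq_R])
    have AX: "A \<subseteq> X"
      using A by (simp add: restriction_def)
    have "card A < card X"
      using A(2) x X' fin card_Diff1_less[of X' x] by simp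
    then obtain y where y: "y \<in> X" "A \<subseteq> X - {y}"
      using AX by (metis Diff_empty less_irrefl subset_Diff_insert subsetI subset_antisym)
    have "card (X - {y}) \<le> card A"
      using A(2) x X' fin y by simp
    then have "A = X - {y}"
      using y fin by (intro card_seteq) auto
    then have "rk M A = rk M X"
      using sharp y by (simp add: sharp_factor_def)
    then show ?thesis
      using A(3) AX X' M.rk_restriction[OF AX] M'.rk_restriction[of "X' - {x}" X'] by auto
  qed
  have pos: "0 < rk M' X'"
    using sharp X' by (simp add: sharp_factor_def)
  have "card (?E - X) = card (?E' - X')"
    using X X' fin eq by (simp add: card_Diff_subset)
  then have nullity: "rk M' ?E' < rk M' X' + card (?E' - X')"
    using sharp X' eq by (simp add: sharp_factor_def)
  \<comment> \<open>\<open>?F\<close> and \<open>?F'\<close> hold the bases of the free products of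
    the minors, \<open>?B\<close> and \<open>?B'\<close> those of \<open>M\<close> and
    \<open>M'\<close>. As \<open>?B'\<close> lies in \<open>?F'\<close>, the chain
    \<open>card ?F' = card ?F \<le> card ?B = card ?B'\<close> forces
    \<open>?B' = ?F'\<close>.\<close>
  let ?F = "{B. B \<subseteq> ?E \<and> card B = ?r \<and> B \<inter> X \<in> indeps M \<and> rk M (B \<union> X) = ?r}"
  let ?F' = "{B. B \<subseteq> ?E' \<and> card B = rk M' ?E' \<and> B \<inter> X' \<in> indeps M' \<and>
    rk M' (B \<union> X') = rk M' ?E'}"
  let ?B = "{B. B \<subseteq> ?E \<and> card B = ?r \<and> rk M B = ?r}"
  let ?B' = "{B. B \<subseteq> ?E' \<and> card B = rk M' ?E' \<and> rk M' B = rk M' ?E'}"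
  have "?F \<subseteq> ?B"
  proof
    fix B assume "B \<in> ?F"
    then have B: "B \<subseteq> ?E" "card B = ?r" "B \<inter> X \<in> indeps M" "rk M (B \<union> X) = ?r"
      by auto
    then have "B \<in> indeps M"
      using sharp by (simp add: sharp_factor_def)
    then show "B \<in> ?B"
      using B by (simp add: M.indep_iff_rk)
  qed
  then have FB: "card ?F \<le> card ?B"
    using M.finite_ground by (intro card_mono) auto
  have "card ?F' = card ?F"
    by (rule trans[OF M'.card_free_product_bases[OF X'(1)]
          trans[OF _ M.card_free_product_bases[OF X, symmetric]]])
      (simp only: card_rank_sets_eq[OF R seq_R] card_rank_sets_eq[OF K seq_K] eq X'(3))
  also note FB
  also have "card ?B = card ?B'"
    using card_rank_sets_eq[OF assms(1-3), of ?r ?r] eq by simp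
  finally have "card ?F' \<le> card ?B'" .
  moreover have "?B' \<subseteq> ?F'"
  proof
    fix B assume "B \<in> ?B'"
    then have B: "B \<subseteq> ?E'" "card B = rk M' ?E'" "rk M' B = rk M' ?E'"
      by auto
    then have "B \<in> indeps M'"
      by (simp add: M'.indep_iff_rk)
    then have "B \<inter> X' \<in> indeps M'"
      by (rule M'.indep_mono) simp
    moreover have "rk M' B \<le> rk M' (B \<union> X')"
      by (rule M'.rk_mono) simp
    moreover have "rk M' (B \<union> X') \<le> rk M' ?E'"
      by (rule M'.rk_mono) (use B X' in blast)
    ultimately show "B \<in> ?F'"
      using B by simp
  qed
  ultimately have BF: "?B' = ?F'"
    using M'.finite_ground by (intro card_seteq) auto
  show ?thesis
  proof (rule M'.proper_free_product_if_bases[OF flat no_coloop pos nullity])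
    fix B assume "B \<subseteq> ?E'" "card B = rk M' ?E'" "B \<inter> X' \<in> indeps M'"
      "rk M' (B \<union> X') = rk M' ?E'"
    then have "B \<in> ?B'"
      unfolding BF by simp
    then show "B \<in> indeps M'"
      by (simp add: M'.indep_iff_rk)
  qed
qed

theorem theorem8p1:
  fixes M :: "'a indep_struct" and M' :: "'b indep_struct"
  assumes "matroid M" and "matroid M'"
    and "(G_inv M :: nat list \<Rightarrow>\<^sub>0 'k::field_char_0) = G_inv M'"
  shows "(proper_free_product M \<longleftrightarrow> proper_free_product M') \<and>
    (\<forall>X X'. pinchpoint M X \<and> pinchpoint M' X' \<and> rk M X = rk M' X' \<longrightarrow>
       (G_inv (restriction M X) :: nat list \<Rightarrow>\<^sub>0 'k) = G_inv (restriction M' X') \<and>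
       (G_inv (contraction M X) :: nat list \<Rightarrow>\<^sub>0 'k) = G_inv (contraction M' X'))"
proof -
  interpret M: matroid M by fact
  interpret M': matroid M' by fact
  have seq: "seq_count M P = seq_count M' P" for P
    using assms(3) unfolding G_inv_eq_iff by blast
  have "(G_inv (restriction M X) :: nat list \<Rightarrow>\<^sub>0 'k) = G_inv (restriction M' X') \<and>
      (G_inv (contraction M X) :: nat list \<Rightarrow>\<^sub>0 'k) = G_inv (contraction M' X')"
    if pinch: "pinchpoint M X" "pinchpoint M' X'" and rk: "rk M X = rk M' X'" for X X'
  proof -
    have X: "X \<subseteq> ground M" "X' \<subseteq> ground M'"
      using pinch by (auto simp: pinchpoint_def cyclic_flats_def flats_def)
    note unique = M.sharp_factor_unique[OF M.pinchpoint_imp_sharp_factor[OF pinch(1)]]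
    note unique' = M'.sharp_factor_unique[OF M'.pinchpoint_imp_sharp_factor[OF pinch(2)]]
    \<comment> \<open>If one were larger, the other matroid would have a set of that size and of the
      same rank; uniqueness among all sets at least as large as its own pinchpoint would identify
      the two, contradicting their sizes.\<close>
    have card: "card X = card X'"
    proof (rule antisym; rule ccontr)
      assume less: "\<not> card X \<le> card X'"
      obtain A where A: "A \<subseteq> ground M'" "card A = card X" "rk M' A = rk M X"
        by (rule ex_same_card_rk[OF assms(2,1) seq[symmetric] X(1)])
      then have "A = X'"
        using less rk by (intro unique') auto
      then show False
        using A less by simp
    next
      assume less: "\<not> card X' \<le> card X"
      obtain A where A: "A \<subseteq> ground M" "card A = card X'" "rk M A = rk M' X'"
        by (rule ex_same_card_rk[OF assms(1,2) seq X(2)])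
      then have "A = X"
        using less rk by (intro unique) auto
      then show False
        using A less by simp
    qed
    note minors = seq_count_minors_eq[OF assms(1,2) seq X card rk]
    show ?thesis
      unfolding G_inv_eq_iff using minors unique unique' by (metis order_refl)
  qed
  moreover have "proper_free_product M \<longleftrightarrow> proper_free_product M'"
    using proper_free_product_transfer[OF assms(1,2) seq]
      proper_free_product_transfer[OF assms(2,1) seq[symmetric]] by blast
  ultimately show ?thesis
    by blast
qed

end
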